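(* Let $\Omega$ be a smooth bounded domain in $\mathbb{R}^n$ and $c\in L^\infty(\Omega)$. Assume that $u\in C^2(\overline{\Omega})$ satisfies $$A_{1/2}u+c(x)u\ge 0\ \text{ in }\Omega,\qquad u=0\ \text{ on }\partial\Omega.$$ Then there exists $\delta>0$, depending only on $n$ and $\|c^-\|_{L^\infty(\Omega)}$, such that if $|\Omega\cap\{u<0\}|\le\delta$ then $u\ge 0$ in $\Omega$.
   Context: $c^-=\max\{0,-c\}$ is the negative part of $c$ and $|\cdot|$ is Lebesgue measure. $A_{1/2}$ denotes the square root of the Laplacian $-\Delta$ in $\Omega$ with zero Dirichlet boundary values: if $\{\varphi_k\}$ is an orthonormal basis of $L^2(\Omega)$ of Dirichlet eigenfunctions, $-\Delta\varphi_k=\lambda_k\varphi_k$ in $\Omega$, $\varphi_k=0$ on $\partial\Omega$, then $A_{1/2}\left(\sum_k c_k\varphi_k\right)=\sum_k c_k\lambda_k^{1/2}\varphi_k$, which maps $H^1_0(\Omega)$ into $L^2(\Omega)$. Equivalently $A_{1/2}u=-\partial_y v(\cdot,0)$, where $v\in H^1(\Omega\times(0,\infty))$ is the harmonic extension of $u$ to $\Omega\times(0,\infty)$ vanishing on $\partial\Omega\times[0,\infty)$. That $\delta$ depends only on $n$ and $\|c^-\|_{L^\infty(\Omega)}$ means it can be chosen independently of $u$, of $\Omega$, and of $c$ otherwise. *)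

theory Defs
  imports "HOL-Analysis.Analysis" "HOL-Probability.Essential_Supremum"
begin

definition partial :: "'n::finite \<Rightarrow> (real^'n \<Rightarrow> real) \<Rightarrow> real^'n \<Rightarrow> real" where
  "partial i f x = frechet_derivative f (at x) (axis i 1)"

definition laplacian :: "(real^'n::finite \<Rightarrow> real) \<Rightarrow> real^'n \<Rightarrow> real" where
  "laplacian f x = (\<Sum>i\<in>UNIV. partial i (partial i f) x)"

text \<open>The classes \<open>C\<^sup>k(S)\<close> and \<open>C\<^sup>k(closure S)\<close>, for open \<open>S\<close>. The latter asks that every
  partial derivative of order at most \<open>k\<close>, taken in \<open>S\<close>, extends continuously to the closure
  (for order \<open>0\<close> the extension is the function itself, so its boundary values are meaningful);
  the derivatives are only ever evaluated inside \<open>S\<close>.\<close>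

primrec Ck_on :: "nat \<Rightarrow> (real^'n::finite) set \<Rightarrow> (real^'n \<Rightarrow> real) \<Rightarrow> bool" where
  "Ck_on 0 S f \<longleftrightarrow> continuous_on S f"
| "Ck_on (Suc k) S f \<longleftrightarrow> (\<forall>x\<in>S. f differentiable (at x)) \<and> (\<forall>i. Ck_on k S (partial i f))"

primrec Ck_closure :: "nat \<Rightarrow> (real^'n::finite) set \<Rightarrow> (real^'n \<Rightarrow> real) \<Rightarrow> bool" where
  "Ck_closure 0 S f \<longleftrightarrow> continuous_on (closure S) f"
| "Ck_closure (Suc k) S f \<longleftrightarrow>
     continuous_on (closure S) f \<and> (\<forall>x\<in>S. f differentiable (at x)) \<and>
     (\<forall>i. \<exists>g. (\<forall>x\<in>S. g x = partial i f x) \<and> Ck_closure k S g)"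

text \<open>Near each boundary point the set is, up to permuting and reflecting coordinates, the region
  above the graph of a smooth function \<open>\<gamma>\<close> of the other \<open>n - 1\<close> coordinates. Such a \<open>\<gamma>\<close> is
  represented by a function of all coordinates that is constant along the \<open>i\<close>-th axis.\<close>

definition smooth_boundary :: "(real^'n::finite) set \<Rightarrow> bool" where
  "smooth_boundary \<Omega> \<longleftrightarrow>
     (\<forall>p\<in>frontier \<Omega>. \<exists>r>0. \<exists>i. \<exists>s\<in>{1, -1}. \<exists>\<gamma> :: real^'n \<Rightarrow> real.
        (\<forall>k. Ck_on k UNIV \<gamma>) \<and> (\<forall>x t. \<gamma> (x + t *\<^sub>R axis i 1) = \<gamma> x) \<and>
        \<Omega> \<inter> ball p r = {x \<in> ball p r. s * x $ i > \<gamma> x})"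

definition smooth_bounded_domain :: "(real^'n::finite) set \<Rightarrow> bool" where
  "smooth_bounded_domain \<Omega> \<longleftrightarrow>
     open \<Omega> \<and> connected \<Omega> \<and> \<Omega> \<noteq> {} \<and> bounded \<Omega> \<and> smooth_boundary \<Omega>"

definition Linf_norm :: "(real^'n::finite) set \<Rightarrow> (real^'n \<Rightarrow> real) \<Rightarrow> real" where
  "Linf_norm \<Omega> f = enn2real (esssup (lebesgue_on \<Omega>) (\<lambda>x. ennreal \<bar>f x\<bar>))"

definition Linf :: "(real^'n::finite) set \<Rightarrow> (real^'n \<Rightarrow> real) \<Rightarrow> bool" where
  "Linf \<Omega> f \<longleftrightarrow> f \<in> borel_measurable (lebesgue_on \<Omega>) \<and>
     esssup (lebesgue_on \<Omega>) (\<lambda>x. ennreal \<bar>f x\<bar>) < \<infinity>"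

definition L2 :: "(real^'n::finite) set \<Rightarrow> (real^'n \<Rightarrow> real) \<Rightarrow> bool" where
  "L2 \<Omega> f \<longleftrightarrow> f \<in> borel_measurable (lebesgue_on \<Omega>) \<and> integrable (lebesgue_on \<Omega>) (\<lambda>x. (f x)\<^sup>2)"

definition L2_inner :: "(real^'n::finite) set \<Rightarrow> (real^'n \<Rightarrow> real) \<Rightarrow> (real^'n \<Rightarrow> real) \<Rightarrow> real" where
  "L2_inner \<Omega> f g = integral\<^sup>L (lebesgue_on \<Omega>) (\<lambda>x. f x * g x)"

definition L2_sums :: "(real^'n::finite) set \<Rightarrow> (nat \<Rightarrow> real^'n \<Rightarrow> real) \<Rightarrow> (real^'n \<Rightarrow> real) \<Rightarrow> bool" where
  "L2_sums \<Omega> g f \<longleftrightarrow> (\<forall>k. L2 \<Omega> (g k)) \<and> L2 \<Omega> f \<and>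
     (\<lambda>N. integral\<^sup>L (lebesgue_on \<Omega>) (\<lambda>x. (f x - (\<Sum>k<N. g k x))\<^sup>2)) \<longlonglongrightarrow> 0"

text \<open>An orthonormal (Hilbert) basis \<open>\<phi>\<close> of \<open>L\<^sup>2(\<Omega>)\<close> consisting of classical Dirichlet
  eigenfunctions, with eigenvalues \<open>ev\<close>.\<close>

definition dirichlet_eigenbasis ::
  "(real^'n::finite) set \<Rightarrow> (nat \<Rightarrow> real^'n \<Rightarrow> real) \<Rightarrow> (nat \<Rightarrow> real) \<Rightarrow> bool" where
  "dirichlet_eigenbasis \<Omega> \<phi> ev \<longleftrightarrow>
     (\<forall>k. Ck_on 2 \<Omega> (\<phi> k) \<and> continuous_on (closure \<Omega>) (\<phi> k) \<and>
          (\<forall>x\<in>\<Omega>. - laplacian (\<phi> k) x = ev k * \<phi> k x) \<and>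
          (\<forall>x\<in>frontier \<Omega>. \<phi> k x = 0)) \<and>
     (\<forall>j k. L2_inner \<Omega> (\<phi> j) (\<phi> k) = (if j = k then 1 else 0)) \<and>
     (\<forall>f. L2 \<Omega> f \<longrightarrow> L2_sums \<Omega> (\<lambda>k x. L2_inner \<Omega> f (\<phi> k) * \<phi> k x) f)"

text \<open>\<open>has_half_laplacian \<Omega> u w\<close> says that \<open>w\<close> is (a representative of) \<open>A\<^sub>1\<^sub>/\<^sub>2 u\<close>. As for
  \<open>has_derivative\<close> and \<open>has_integral\<close>, the operator is given as a relation between a function
  and its image; \<open>w\<close> is determined up to a null set and does not depend on the basis. On a smooth
  bounded domain it exists for every \<open>u\<close> in \<open>H\<^sup>1\<^sub>0(\<Omega>)\<close>, in particular for every
  \<open>u\<close> in \<open>C\<^sup>2(closure \<Omega>)\<close> vanishing on the boundary.\<close>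

definition has_half_laplacian ::
  "(real^'n::finite) set \<Rightarrow> (real^'n \<Rightarrow> real) \<Rightarrow> (real^'n \<Rightarrow> real) \<Rightarrow> bool" where
  "has_half_laplacian \<Omega> u w \<longleftrightarrow>
     (\<exists>\<phi> ev a. dirichlet_eigenbasis \<Omega> \<phi> ev \<and>
        L2_sums \<Omega> (\<lambda>k x. a k * \<phi> k x) u \<and>
        L2_sums \<Omega> (\<lambda>k x. a k * sqrt (ev k) * \<phi> k x) w)"

end

theory Submission
  imports Defs
begin

text \<open>
  Write \<open>f = u\<^sup>-\<close> and \<open>m\<^sub>k = \<langle>f, \<phi>\<^sub>k\<rangle>\<close>, and let \<open>E = \<Sum> \<surd>ev\<^sub>k m\<^sub>k\<^sup>2\<close> be the quadratic form of
  \<open>A\<^sub>1\<^sub>/\<^sub>2\<close> at \<open>f\<close>. The proof bounds \<open>E\<close> from above by testing the inequality with \<open>f\<close>, and shows that a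
  nonzero function living on a small set has a large \<open>E\<close>.

  \<^bold>\<open>Upper bound\<close> (\<open>half_energy_negative_part\<close>). Multiplying \<open>w + c u \<ge> 0\<close> by \<open>f\<close> gives
  \<open>-\<langle>w, f\<rangle> \<le> M \<parallel>f\<parallel>\<^sup>2\<close> with \<open>M = \<parallel>c\<^sup>-\<parallel>\<close>, and \<open>E \<le> -\<langle>w, f\<rangle>\<close> holds because the cross term between
  \<open>u\<^sup>+\<close> and \<open>u\<^sup>-\<close> in the quadratic form is nonpositive. For the bounded operators
  \<open>-\<Delta>(s - \<Delta>)\<^sup>-\<^sup>1 = 1 - s(s - \<Delta>)\<^sup>-\<^sup>1\<close> this sign says that the resolvent preserves positivity
  (\<open>resolvent_positivity\<close>), since \<open>u\<^sup>+\<close> and \<open>u\<^sup>-\<close> are orthogonal. It passes to the square root by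
  \<open>\<surd>x = (2/\<pi>) \<integral>\<^sub>0\<^sup>\<infinity> x / (x + r\<^sup>2) dr\<close>, where the integral is first cut off at a finite radius
  (\<open>half_weight\<close>) to keep all sums absolutely convergent.

  \<^bold>\<open>Lower bound\<close> (\<open>translation_half_energy\<close>, \<open>small_support_large_translation\<close>). Extend \<open>f\<close> by zero.
  Splitting \<open>f\<close> into its frequencies below and above \<open>1/\<bar>v\<bar>\<^sup>2\<close> yields
  \<open>\<parallel>f(\<cdot> + v) - f\<parallel>\<^sup>2 \<le> 8 \<bar>v\<bar> E\<close>: on the low frequencies a translation costs at most \<open>\<bar>v\<bar>\<close> times the
  gradient, on the high ones at most a multiple of the norm, and \<open>min(1, \<bar>v\<bar>\<^sup>2x) \<le> \<bar>v\<bar>\<surd>x\<close>.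
  On the other hand, if \<open>f\<close> lives on a set \<open>A\<close> and \<open>v\<close> is averaged over a ball \<open>B\<close>, then the mean of
  \<open>\<parallel>f(\<cdot> + v) - f\<parallel>\<^sup>2\<close> is at least \<open>2 (1 - |A|/|B|) \<parallel>f\<parallel>\<^sup>2\<close>. With a ball of radius
  \<open>r = 1/(16(M + 1))\<close> and \<open>|A| \<le> |B|/2\<close>, the two bounds contradict each other unless \<open>f = 0\<close>.

  Both halves rest on the Dirichlet energy of finite eigenfunction combinations. Eigenfunctions are
  \<open>C\<^sup>2\<close> inside \<open>\<Omega>\<close> but only continuous up to the boundary, so Green's formula is applied to
  truncations \<open>G(h)\<close> that vanish where \<open>\<bar>h\<bar>\<close> is small. These have compact support in \<open>\<Omega>\<close>, and the
  boundary never appears.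
\<close>

section \<open>Translations and directional derivatives in the Lebesgue integral\<close>

text \<open>A class on which every integral below exists and which is closed under products, sums and
  translations, so that integrability never has to be argued by estimates. One radius serves both as
  a bound for the values and for the support.\<close>

definition bounded_supp :: "('a::euclidean_space \<Rightarrow> real) \<Rightarrow> bool" where
  "bounded_supp g \<longleftrightarrow> g \<in> borel_measurable borel \<and> (\<exists>R. \<forall>x. \<bar>g x\<bar> \<le> R \<and> (R < norm x \<longrightarrow> g x = 0))"

lemma bounded_suppI:
  assumes "g \<in> borel_measurable borel" "\<And>x. \<bar>g x\<bar> \<le> B" "\<And>x. R < norm x \<Longrightarrow> g x = 0"
  shows "bounded_supp g"
  unfolding bounded_supp_def using assms
  by (intro conjI exI[of _ "max B R"]) (auto simp: le_max_iff_disj)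

lemma bounded_suppE:
  assumes "bounded_supp g"
  obtains R where "R > 0" "\<And>x. \<bar>g x\<bar> \<le> R" "\<And>x. R < norm x \<Longrightarrow> g x = 0"
proof -
  obtain R where R: "\<And>x. \<bar>g x\<bar> \<le> R \<and> (R < norm x \<longrightarrow> g x = 0)"
    using assms by (auto simp: bounded_supp_def)
  show ?thesis
    by (rule that[of "max R 1"]) (use R in \<open>auto simp: le_max_iff_disj\<close>)
qed

lemma bounded_supp_measurable: "bounded_supp g \<Longrightarrow> g \<in> borel_measurable borel"
  by (simp add: bounded_supp_def)

lemma integrable_bounded_supp:
  assumes "bounded_supp g"
  shows "integrable lborel g"
proof -
  obtain R where R: "\<And>x. \<bar>g x\<bar> \<le> R" "\<And>x. R < norm x \<Longrightarrow> g x = 0"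
    using assms by (rule bounded_suppE) blast
  show ?thesis
    by (rule integrableI_bounded_set[where A="cball 0 R" and B=R])
      (use R bounded_supp_measurable[OF assms] emeasure_lborel_cball_finite[of 0 R]
       in \<open>auto simp: less_top[symmetric]\<close>)
qed

lemma bounded_supp_mult:
  assumes "bounded_supp f" "bounded_supp g"
  shows "bounded_supp (\<lambda>x. f x * g x)"
proof -
  obtain R where R: "R > 0" "\<And>x. \<bar>f x\<bar> \<le> R" "\<And>x. R < norm x \<Longrightarrow> f x = 0"
    using assms(1) by (rule bounded_suppE) blast
  obtain S where S: "S > 0" "\<And>x. \<bar>g x\<bar> \<le> S"
    using assms(2) by (rule bounded_suppE) blast
  show ?thesis
  proof (rule bounded_suppI[where B="R * S" and R=R])
    show "(\<lambda>x. f x * g x) \<in> borel_measurable borel"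
      using assms[THEN bounded_supp_measurable] by simp
    show "\<bar>f x * g x\<bar> \<le> R * S" for x
      unfolding abs_mult using R S by (intro mult_mono) (auto simp: less_imp_le)
    show "R < norm x \<Longrightarrow> f x * g x = 0" for x
      using R by simp
  qed
qed

lemma bounded_supp_add:
  assumes "bounded_supp f" "bounded_supp g"
  shows "bounded_supp (\<lambda>x. f x + g x)"
proof -
  obtain R where R: "R > 0" "\<And>x. \<bar>f x\<bar> \<le> R" "\<And>x. R < norm x \<Longrightarrow> f x = 0"
    using assms(1) by (rule bounded_suppE) blast
  obtain S where S: "S > 0" "\<And>x. \<bar>g x\<bar> \<le> S" "\<And>x. S < norm x \<Longrightarrow> g x = 0"
    using assms(2) by (rule bounded_suppE) blast
  show ?thesis
  proof (rule bounded_suppI[where B="R + S" and R="R + S"])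
    show "(\<lambda>x. f x + g x) \<in> borel_measurable borel"
      using assms[THEN bounded_supp_measurable] by simp
    show "\<bar>f x + g x\<bar> \<le> R + S" for x
      using R(2)[of x] S(2)[of x] by linarith
    show "R + S < norm x \<Longrightarrow> f x + g x = 0" for x
      using R S by simp
  qed
qed

lemma bounded_supp_cmult:
  assumes "bounded_supp f"
  shows "bounded_supp (\<lambda>x. c * f x)"
proof -
  obtain R where R: "R > 0" "\<And>x. \<bar>f x\<bar> \<le> R" "\<And>x. R < norm x \<Longrightarrow> f x = 0"
    using assms(1) by (rule bounded_suppE) blast
  show ?thesis
    by (rule bounded_suppI[where B="\<bar>c\<bar> * R" and R=R])
      (use R bounded_supp_measurable[OF assms] in \<open>auto simp: abs_mult mult_left_mono\<close>)
qed

lemma bounded_supp_diff: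
  assumes "bounded_supp f" "bounded_supp g"
  shows "bounded_supp (\<lambda>x. f x - g x)"
  using bounded_supp_add[OF assms(1) bounded_supp_cmult[OF assms(2), of "-1"]] by simp

lemma bounded_supp_power2:
  "bounded_supp f \<Longrightarrow> bounded_supp (\<lambda>x. (f x)\<^sup>2)"
  unfolding power2_eq_square by (rule bounded_supp_mult)

lemma bounded_supp_translate:
  assumes "bounded_supp f"
  shows "bounded_supp (\<lambda>x. f (x + v))"
proof -
  obtain R where R: "R > 0" "\<And>x. \<bar>f x\<bar> \<le> R" "\<And>x. R < norm x \<Longrightarrow> f x = 0"
    using assms(1) by (rule bounded_suppE) blast
  have "f (x + v) = 0" if "R + norm v < norm x" for x
    by (rule R(3)) (use that norm_diff_ineq[of x v] in linarith)
  moreover have "(\<lambda>x. f (x + v)) \<in> borel_measurable borel"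
    using bounded_supp_measurable[OF assms] by measurable
  ultimately show ?thesis
    using R by (intro bounded_suppI[where B=R and R="R + norm v"]) auto
qed

lemmas bounded_supp_intros =
  bounded_supp_mult bounded_supp_add bounded_supp_cmult bounded_supp_diff
  bounded_supp_power2

lemma bounded_supp_continuous:
  fixes g :: "'a::euclidean_space \<Rightarrow> real"
  assumes "continuous_on UNIV g" "bounded K" "\<And>x. x \<notin> K \<Longrightarrow> g x = 0"
  shows "bounded_supp g"
proof -
  obtain R where R: "K \<subseteq> cball 0 R"
    using bounded_subset_ballD[OF assms(2), of 0] ball_subset_cball by blast
  have "compact (g ` cball 0 R)"
    by (intro compact_continuous_image continuous_on_subset[OF assms(1)]) auto
  then obtain B where B: "\<And>x. x \<in> cball 0 R \<Longrightarrow> \<bar>g x\<bar> \<le> B"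
    using compact_imp_bounded by (force simp: bounded_iff)
  show ?thesis
  proof (rule bounded_suppI[where R=R and B="max B 0"])
    show "g \<in> borel_measurable borel"
      using assms(1) by (rule borel_measurable_continuous_onI)
    show "\<bar>g x\<bar> \<le> max B 0" for x
      using B[of x] assms(3)[of x] R by (cases "x \<in> K") (auto simp: le_max_iff_disj)
    show "R < norm x \<Longrightarrow> g x = 0" for x
      using R assms(3) by force
  qed
qed

lemma integral_lborel_translate:
  fixes f :: "'a::euclidean_space \<Rightarrow> real"
  assumes "f \<in> borel_measurable borel"
  shows "integral\<^sup>L lborel (\<lambda>x. f (x + v)) = integral\<^sup>L lborel f"
proof -
  have "integral\<^sup>L lborel f = integral\<^sup>L (distr lborel borel ((+) v)) f"
    by (simp add: lborel_distr_plus)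
  also have "\<dots> = integral\<^sup>L lborel (\<lambda>x. f (v + x))"
    using assms by (subst integral_distr) auto
  finally show ?thesis by (simp add: add.commute)
qed

text \<open>Dominated convergence: by the mean value theorem the difference quotients are bounded by the
  supremum of \<open>D\<close>, and their displacements are at most \<open>\<bar>v\<bar>\<close>, so they vanish outside a
  common ball.\<close>

lemma difference_quotient_integrals:
  fixes \<psi> :: "'a::euclidean_space \<Rightarrow> real"
  assumes deriv: "\<And>x. (\<psi> has_derivative \<psi>' x) (at x)"
    and D: "\<And>x. \<psi>' x v = D x" and contD: "continuous_on UNIV D"
    and K: "bounded K" "\<And>x. x \<notin> K \<Longrightarrow> \<psi> x = 0" "\<And>x. x \<notin> K \<Longrightarrow> D x = 0"
  shows "(\<lambda>N. \<integral>x. real (Suc N) * (\<psi> (x + (1 / real (Suc N)) *\<^sub>R v) - \<psi> x) \<partial>lborel)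
            \<longlonglongrightarrow> (\<integral>x. D x \<partial>lborel)"
    and "(\<lambda>N. \<integral>x. (real (Suc N) * (\<psi> (x + (1 / real (Suc N)) *\<^sub>R v) - \<psi> x))\<^sup>2 \<partial>lborel)
            \<longlonglongrightarrow> (\<integral>x. (D x)\<^sup>2 \<partial>lborel)"
proof -
  define t where "t N = 1 / real (Suc N)" for N
  define q where "q N x = real (Suc N) * (\<psi> (x + t N *\<^sub>R v) - \<psi> x)" for N x
  have t: "t N > 0" "t N \<le> 1" "real (Suc N) * t N = 1" for N
    by (auto simp: t_def)
  have cont\<psi>: "continuous_on UNIV \<psi>"
    using deriv by (auto intro!: continuous_at_imp_continuous_on has_derivative_continuous)
  have bs: "bounded_supp \<psi>" "bounded_supp D"
    using bounded_supp_continuous[OF cont\<psi> K(1)] bounded_supp_continuous[OF contD K(1)] K by auto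
  have along: "((\<lambda>s. \<psi> (x + s *\<^sub>R v)) has_real_derivative D (x + s *\<^sub>R v)) (at s within S)" for x s S
  proof -
    have "((\<lambda>s. \<psi> (x + s *\<^sub>R v)) has_derivative (\<lambda>h. \<psi>' (x + s *\<^sub>R v) (h *\<^sub>R v))) (at s within S)"
      by (rule has_derivative_compose[OF _ deriv]) (auto intro!: derivative_eq_intros)
    moreover have "\<psi>' (x + s *\<^sub>R v) (h *\<^sub>R v) = h * D (x + s *\<^sub>R v)" for h
      using linear_cmul[OF has_derivative_linear[OF deriv], of "x + s *\<^sub>R v" h v] D by simp
    ultimately show ?thesis
      by (simp add: has_field_derivative_def mult_commute_abs)
  qed
  obtain R where R: "R > 0" "\<And>x. \<bar>D x\<bar> \<le> R"
    using bs(2) by (rule bounded_suppE) blast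
  obtain S where S: "S > 0" "\<And>x. S < norm x \<Longrightarrow> \<psi> x = 0"
    using bs(1) by (rule bounded_suppE) blast
  have qbound: "\<bar>q N x\<bar> \<le> R" for N x
  proof -
    obtain z where "\<psi> (x + t N *\<^sub>R v) - \<psi> (x + 0 *\<^sub>R v) = (t N - 0) * D (x + z *\<^sub>R v)"
      using MVT2[of 0 "t N" "\<lambda>s. \<psi> (x + s *\<^sub>R v)" "\<lambda>s. D (x + s *\<^sub>R v)"] t(1) along by blast
    then have "q N x = (real (Suc N) * t N) * D (x + z *\<^sub>R v)"
      by (simp add: q_def)
    then show ?thesis using t(3) R by simp
  qed
  have qzero: "q N x = 0" if "norm x > S + norm v" for N x
  proof -
    have "norm (t N *\<^sub>R v) \<le> norm v"
      using t[of N] by (simp add: mult_left_le_one_le)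
    then have "S < norm (x + t N *\<^sub>R v)"
      using that norm_diff_ineq[of x "t N *\<^sub>R v"] by linarith
    then show ?thesis
      using S(2)[of x] S(2)[of "x + t N *\<^sub>R v"] that norm_ge_zero[of v] by (simp add: q_def)
  qed
  have qlim: "(\<lambda>N. q N x) \<longlonglongrightarrow> D x" for x
  proof -
    have "((\<lambda>s. (\<psi> (x + (0 + s) *\<^sub>R v) - \<psi> (x + 0 *\<^sub>R v)) / s) \<longlongrightarrow> D (x + 0 *\<^sub>R v)) (at 0)"
      using along[of x 0 UNIV] unfolding DERIV_def .
    moreover have "filterlim t (at 0) sequentially"
      unfolding filterlim_at t_def using LIMSEQ_inverse_real_of_nat by (auto simp: inverse_eq_divide)
    ultimately have "(\<lambda>N. (\<psi> (x + (0 + t N) *\<^sub>R v) - \<psi> (x + 0 *\<^sub>R v)) / t N) \<longlonglongrightarrow> D (x + 0 *\<^sub>R v)"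
      by (rule filterlim_compose)
    then show ?thesis by (simp add: q_def t_def mult.commute)
  qed
  have meas: "q N \<in> borel_measurable borel" "D \<in> borel_measurable borel" for N
    unfolding q_def using bs[THEN bounded_supp_measurable] by measurable
  define w :: "real \<Rightarrow> 'a \<Rightarrow> real" where "w B x = B * indicator (cball 0 (S + norm v)) x" for B x
  have w: "integrable lborel (w B)" for B
    unfolding w_def using emeasure_lborel_cball_finite[of "0::'a"]
    by (intro integrable_mult_right integrable_real_indicator) auto
  have "(\<lambda>N. integral\<^sup>L lborel (q N)) \<longlonglongrightarrow> integral\<^sup>L lborel D"
  proof (rule integral_dominated_convergence[where w="w R"])
    show "AE x in lborel. norm (q N x) \<le> w R x" for N
      using qbound[of N] qzero by (auto simp: w_def indicator_def)
  qed (use meas qlim w in auto)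
  then show "(\<lambda>N. \<integral>x. real (Suc N) * (\<psi> (x + (1 / real (Suc N)) *\<^sub>R v) - \<psi> x) \<partial>lborel)
            \<longlonglongrightarrow> (\<integral>x. D x \<partial>lborel)"
    by (simp only: q_def[abs_def] t_def)
  have "(\<lambda>N. integral\<^sup>L lborel (\<lambda>x. (q N x)\<^sup>2)) \<longlonglongrightarrow> integral\<^sup>L lborel (\<lambda>x. (D x)\<^sup>2)"
  proof (rule integral_dominated_convergence[where w="w (R\<^sup>2)"])
    show "AE x in lborel. norm ((q N x)\<^sup>2) \<le> w (R\<^sup>2) x" for N
      using qbound[of N] qzero R by (auto simp: w_def indicator_def abs_le_square_iff[symmetric])
    show "AE x in lborel. (\<lambda>N. (q N x)\<^sup>2) \<longlonglongrightarrow> (D x)\<^sup>2"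
      by (intro AE_I2 tendsto_power qlim)
  qed (use meas w in auto)
  then show "(\<lambda>N. \<integral>x. (real (Suc N) * (\<psi> (x + (1 / real (Suc N)) *\<^sub>R v) - \<psi> x))\<^sup>2 \<partial>lborel)
            \<longlonglongrightarrow> (\<integral>x. (D x)\<^sup>2 \<partial>lborel)"
    by (simp add: q_def t_def)
qed

text \<open>The divergence theorem for compact support: each difference quotient has integral zero by
  translation invariance.\<close>

lemma integral_directional_derivative_zero:
  fixes \<psi> :: "'a::euclidean_space \<Rightarrow> real"
  assumes deriv: "\<And>x. (\<psi> has_derivative \<psi>' x) (at x)"
    and D: "\<And>x. \<psi>' x v = D x" and contD: "continuous_on UNIV D"
    and K: "bounded K" "\<And>x. x \<notin> K \<Longrightarrow> \<psi> x = 0" "\<And>x. x \<notin> K \<Longrightarrow> D x = 0"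
  shows "(\<integral>x. D x \<partial>lborel) = 0"
proof -
  have "continuous_on UNIV \<psi>"
    using deriv by (auto intro!: continuous_at_imp_continuous_on has_derivative_continuous)
  then have bs: "bounded_supp \<psi>"
    using bounded_supp_continuous K by blast
  have "(\<integral>x. real (Suc N) * (\<psi> (x + (1 / real (Suc N)) *\<^sub>R v) - \<psi> x) \<partial>lborel) = 0" for N
    using integral_lborel_translate[OF bounded_supp_measurable[OF bs]]
    by (simp add: integrable_bounded_supp bounded_supp_translate bs del: of_nat_Suc)
  then have "(\<lambda>_. 0) \<longlonglongrightarrow> (\<integral>x. D x \<partial>lborel)"
    using difference_quotient_integrals(1)[OF assms] by (simp del: of_nat_Suc)
  then show ?thesis
    using LIMSEQ_unique tendsto_const by metis
qed

text \<open>Split the translation by \<open>v\<close> into \<open>n\<close> steps of length \<open>1/n\<close>. The inequality between the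
  arithmetic and the quadratic mean, together with translation invariance, bounds the left side by
  the square integral of the \<open>n\<close>-th difference quotient, for every \<open>n\<close>.\<close>

lemma integral_translation_difference_le:
  fixes \<psi> :: "'a::euclidean_space \<Rightarrow> real"
  assumes deriv: "\<And>x. (\<psi> has_derivative \<psi>' x) (at x)"
    and D: "\<And>x. \<psi>' x v = D x" and contD: "continuous_on UNIV D"
    and K: "bounded K" "\<And>x. x \<notin> K \<Longrightarrow> \<psi> x = 0" "\<And>x. x \<notin> K \<Longrightarrow> D x = 0"
  shows "(\<integral>x. (\<psi> (x + v) - \<psi> x)\<^sup>2 \<partial>lborel) \<le> (\<integral>x. (D x)\<^sup>2 \<partial>lborel)"
proof -
  have "continuous_on UNIV \<psi>"
    using deriv by (auto intro!: continuous_at_imp_continuous_on has_derivative_continuous)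
  then have bs: "bounded_supp \<psi>"
    using bounded_supp_continuous K by blast
  have "(\<integral>x. (\<psi> (x + v) - \<psi> x)\<^sup>2 \<partial>lborel)
      \<le> (\<integral>x. (real (Suc N) * (\<psi> (x + (1 / real (Suc N)) *\<^sub>R v) - \<psi> x))\<^sup>2 \<partial>lborel)" for N
  proof -
    define n where "n = Suc N"
    define s where "s = 1 / real n"
    define d where "d x = \<psi> (x + s *\<^sub>R v) - \<psi> x" for x
    have bsd: "bounded_supp d"
      unfolding d_def by (intro bounded_supp_intros bounded_supp_translate[OF bs] bs)
    have ptw: "(\<psi> (x + v) - \<psi> x)\<^sup>2 \<le> real n * (\<Sum>j<n. (d (x + (real j * s) *\<^sub>R v))\<^sup>2)" for x
    proof -
      have "(\<Sum>j<n. d (x + (real j * s) *\<^sub>R v)) = (\<Sum>j<n. \<psi> (x + (real (Suc j) * s) *\<^sub>R v) - \<psi> (x + (real j * s) *\<^sub>R v))"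
        by (intro sum.cong) (auto simp: d_def algebra_simps)
      also have "\<dots> = \<psi> (x + v) - \<psi> x"
        by (subst sum_lessThan_telescope) (simp add: s_def n_def)
      finally have "(\<psi> (x + v) - \<psi> x)\<^sup>2 = (\<Sum>j<n. d (x + (real j * s) *\<^sub>R v))\<^sup>2" by simp
      also have "\<dots> \<le> (\<Sum>j<n. (d (x + (real j * s) *\<^sub>R v))\<^sup>2) * real (card {..<n})"
        by (rule sum_squared_le_sum_of_squares)
      finally show ?thesis by (simp add: mult.commute)
    qed
    have bsj: "bounded_supp (\<lambda>x. (d (x + (real j * s) *\<^sub>R v))\<^sup>2)" for j
      by (intro bounded_supp_intros bounded_supp_translate[OF bsd])
    have "(\<integral>x. (\<psi> (x + v) - \<psi> x)\<^sup>2 \<partial>lborel) \<le> (\<integral>x. real n * (\<Sum>j<n. (d (x + (real j * s) *\<^sub>R v))\<^sup>2) \<partial>lborel)"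
      by (intro integral_mono ptw integrable_mult_right Bochner_Integration.integrable_sum integrable_bounded_supp bsj)
        (intro integrable_bounded_supp bounded_supp_intros bounded_supp_translate[OF bs] bs)
    also have "\<dots> = real n * (\<Sum>j<n. \<integral>x. (d (x + (real j * s) *\<^sub>R v))\<^sup>2 \<partial>lborel)"
      by (simp add: integrable_bounded_supp[OF bsj])
    also have "\<dots> = real n * (\<Sum>j<n. \<integral>x. (d x)\<^sup>2 \<partial>lborel)"
      using integral_lborel_translate[of "\<lambda>x. (d x)\<^sup>2"] bounded_supp_measurable[OF bsd] by simp
    also have "\<dots> = (\<integral>x. (real n * d x)\<^sup>2 \<partial>lborel)"
      by (simp add: power_mult_distrib) (simp add: power2_eq_square)
    finally show ?thesis by (simp add: d_def s_def n_def)
  qed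
  then show ?thesis
    by (intro LIMSEQ_le_const[OF difference_quotient_integrals(2)[OF assms]]) auto
qed

section \<open>A smooth truncation of the positive part\<close>

text \<open>A \<open>C\<^sup>1\<close> approximation of the positive part that vanishes below \<open>\<epsilon>\<close> and has slope in
  \<open>[0, 1]\<close>. For \<open>s > \<epsilon>\<close> its value is \<open>(s - \<epsilon>)\<^sup>2 / s\<close>.\<close>

definition soft_pos :: "real \<Rightarrow> real \<Rightarrow> real" where
  "soft_pos \<epsilon> s = (if s \<le> \<epsilon> then 0 else s - 2 * \<epsilon> + \<epsilon>\<^sup>2 / s)"

definition soft_pos_deriv :: "real \<Rightarrow> real \<Rightarrow> real" where
  "soft_pos_deriv \<epsilon> s = (if s \<le> \<epsilon> then 0 else 1 - \<epsilon>\<^sup>2 / s\<^sup>2)"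

lemma soft_pos_square: "s > 0 \<Longrightarrow> s - 2 * \<epsilon> + \<epsilon>\<^sup>2 / s = (s - \<epsilon>)\<^sup>2 / (s::real)"
  by (simp add: field_simps power2_eq_square)

lemma has_real_derivative_soft_pos:
  assumes "\<epsilon> > 0"
  shows "(soft_pos \<epsilon> has_real_derivative soft_pos_deriv \<epsilon> s) (at s)"
proof (cases s \<epsilon> rule: linorder_cases)
  case less
  have "((\<lambda>_. 0) has_real_derivative 0) (at s)" by simp
  then show ?thesis
    using less has_field_derivative_transform_within_open[of "\<lambda>_. 0" 0 s "{..<\<epsilon>}" "soft_pos \<epsilon>"]
    by (simp add: soft_pos_def soft_pos_deriv_def)
next
  case greater
  have "((\<lambda>s. s - 2 * \<epsilon> + \<epsilon>\<^sup>2 / s) has_real_derivative 1 - \<epsilon>\<^sup>2 / s\<^sup>2) (at s)"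
    using assms greater by (auto intro!: derivative_eq_intros simp: power2_eq_square)
  then show ?thesis
    using greater has_field_derivative_transform_within_open[of "\<lambda>s. s - 2 * \<epsilon> + \<epsilon>\<^sup>2 / s" _ s "{\<epsilon><..}" "soft_pos \<epsilon>"]
    by (simp add: soft_pos_def soft_pos_deriv_def)
next
  case equal
  have "(soft_pos \<epsilon> has_derivative (*) 0) (at \<epsilon>)"
    unfolding lambda_zero[symmetric]
  proof (rule has_derivativeI_sandwich[where e=1 and H="\<lambda>y. \<bar>y - \<epsilon>\<bar> / \<epsilon>"])
    fix y assume y: "y \<noteq> \<epsilon>"
    have "\<bar>soft_pos \<epsilon> y\<bar> \<le> \<bar>y - \<epsilon>\<bar>\<^sup>2 / \<epsilon>"
    proof (cases "y \<le> \<epsilon>")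
      case False
      then have "\<bar>soft_pos \<epsilon> y\<bar> = (y - \<epsilon>)\<^sup>2 / y"
        using assms soft_pos_square[of y \<epsilon>] by (simp add: soft_pos_def)
      also have "\<dots> \<le> (y - \<epsilon>)\<^sup>2 / \<epsilon>"
        using assms False by (intro divide_left_mono) auto
      finally show ?thesis by simp
    qed (use assms in \<open>simp add: soft_pos_def\<close>)
    then show "norm (soft_pos \<epsilon> y - soft_pos \<epsilon> \<epsilon> - 0) / norm (y - \<epsilon>) \<le> \<bar>y - \<epsilon>\<bar> / \<epsilon>"
      using y assms by (simp add: soft_pos_def[of \<epsilon> \<epsilon>] field_simps power2_eq_square)
  next
    show "((\<lambda>y. \<bar>y - \<epsilon>\<bar> / \<epsilon>) \<longlongrightarrow> 0) (at \<epsilon>)"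
      using assms by (auto intro!: tendsto_eq_intros)
  qed auto
  then show ?thesis
    using equal by (simp add: soft_pos_deriv_def has_field_derivative_def)
qed

lemma soft_pos_deriv_bounds:
  assumes "\<epsilon> > 0"
  shows "0 \<le> soft_pos_deriv \<epsilon> s" "soft_pos_deriv \<epsilon> s \<le> 1"
  using assms by (auto simp: soft_pos_deriv_def power_mono)

lemma continuous_soft_pos_deriv:
  assumes "\<epsilon> > 0"
  shows "continuous_on UNIV (soft_pos_deriv \<epsilon>)"
proof -
  have "soft_pos_deriv \<epsilon> = (\<lambda>s. 1 - \<epsilon>\<^sup>2 / (max s \<epsilon>)\<^sup>2)"
    using assms by (auto simp: soft_pos_deriv_def max_def fun_eq_iff)
  moreover have "continuous_on UNIV (\<lambda>s. 1 - \<epsilon>\<^sup>2 / (max s \<epsilon>)\<^sup>2)"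
    using assms by (intro continuous_intros) (auto simp: max_def)
  ultimately show ?thesis by metis
qed

lemma soft_pos_bounds:
  assumes "\<epsilon> > 0"
  shows "0 \<le> soft_pos \<epsilon> s" "soft_pos \<epsilon> s \<le> max 0 s" "max 0 s - 2 * \<epsilon> \<le> soft_pos \<epsilon> s"
proof -
  show "0 \<le> soft_pos \<epsilon> s"
    using soft_pos_square[of s \<epsilon>] assms by (simp add: soft_pos_def)
  have "\<epsilon>\<^sup>2 / s \<le> \<epsilon>" if "s > \<epsilon>"
    using that assms by (simp add: field_simps power2_eq_square)
  then show "soft_pos \<epsilon> s \<le> max 0 s"
    using assms by (auto simp: soft_pos_def)
  show "max 0 s - 2 * \<epsilon> \<le> soft_pos \<epsilon> s"
    using assms by (auto simp: soft_pos_def)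
qed

lemma soft_pos_tendsto:
  "(\<lambda>n. soft_pos (1 / real (Suc n)) s) \<longlonglongrightarrow> max 0 s"
proof (rule tendsto_sandwich)
  show "(\<lambda>n. max 0 s - 2 * (1 / real (Suc n))) \<longlonglongrightarrow> max 0 s"
    using tendsto_diff[OF tendsto_const tendsto_mult[OF tendsto_const LIMSEQ_inverse_real_of_nat], of "max 0 s" 2]
    by (simp add: inverse_eq_divide)
  show "\<forall>\<^sub>F n in sequentially. max 0 s - 2 * (1 / real (Suc n)) \<le> soft_pos (1 / real (Suc n)) s"
    by (intro always_eventually allI soft_pos_bounds) simp
  show "\<forall>\<^sub>F n in sequentially. soft_pos (1 / real (Suc n)) s \<le> max 0 s"
    by (intro always_eventually allI soft_pos_bounds) simp
qed simp

section \<open>Dirichlet energy of functions with zero boundary values\<close>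

definition zext :: "'a set \<Rightarrow> ('a \<Rightarrow> real) \<Rightarrow> 'a \<Rightarrow> real" where
  "zext \<Omega> f x = (if x \<in> \<Omega> then f x else 0)"

text \<open>\<open>h\<close> has zero boundary values and Laplacian \<open>l\<close>, and continuity of \<open>l\<close> up to the
  boundary makes it bounded when \<open>\<Omega>\<close> is. The derivatives are existential witnesses: \<open>d\<close> is the gradient and \<open>D\<close> its
  derivative, whose trace is the Laplacian. This makes closure under linear combinations immediate,
  whereas with iterated \<^const>\<open>partial\<close> derivatives the first ones would have to be identified in a
  neighbourhood of each point before the second ones can be computed.\<close>

definition dirichlet_laplacian ::
  "(real^'n::finite) set \<Rightarrow> (real^'n \<Rightarrow> real) \<Rightarrow> (real^'n \<Rightarrow> real) \<Rightarrow> bool" where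
  "dirichlet_laplacian \<Omega> h l \<longleftrightarrow>
     continuous_on (closure \<Omega>) h \<and> (\<forall>x\<in>frontier \<Omega>. h x = 0) \<and> continuous_on (closure \<Omega>) l \<and>
     (\<exists>d D. (\<forall>x\<in>\<Omega>. (h has_derivative (\<lambda>v. d x \<bullet> v)) (at x)) \<and>
            (\<forall>x\<in>\<Omega>. (d has_derivative D x) (at x)) \<and>
            (\<forall>i. continuous_on \<Omega> (\<lambda>x. D x (axis i 1) $ i)) \<and>
            (\<forall>x\<in>\<Omega>. l x = (\<Sum>i\<in>UNIV. D x (axis i 1) $ i)))"

lemma bounded_supp_zext:
  fixes f :: "'a::euclidean_space \<Rightarrow> real"
  assumes "open \<Omega>" "bounded \<Omega>" "continuous_on (closure \<Omega>) f"
  shows "bounded_supp (zext \<Omega> f)"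
proof -
  have "compact (closure \<Omega>)"
    using assms(2) compact_closure by blast
  then have "bounded (f ` closure \<Omega>)"
    using assms(3) compact_continuous_image compact_imp_bounded by blast
  then obtain B where B: "\<And>x. x \<in> \<Omega> \<Longrightarrow> \<bar>f x\<bar> \<le> B"
    using closure_subset by (fastforce simp: bounded_iff)
  obtain R where R: "\<And>x. x \<in> \<Omega> \<Longrightarrow> norm x \<le> R"
    using assms(2) by (auto simp: bounded_iff)
  show ?thesis
  proof (rule bounded_suppI[where B="max 0 B" and R=R])
    show "zext \<Omega> f \<in> borel_measurable borel"
      unfolding zext_def using assms(1) continuous_on_subset[OF assms(3) closure_subset]
      by (intro borel_measurable_continuous_on_if) auto
    show "\<bar>zext \<Omega> f x\<bar> \<le> max 0 B" for x
      using B[of x] by (auto simp: zext_def)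
    show "R < norm x \<Longrightarrow> zext \<Omega> f x = 0" for x
      using R[of x] by (auto simp: zext_def)
  qed
qed

lemma continuous_on_zext:
  assumes "open \<Omega>" "closed K" "K \<subseteq> \<Omega>" "continuous_on \<Omega> f" "\<And>x. x \<in> \<Omega> - K \<Longrightarrow> f x = 0"
  shows "continuous_on UNIV (zext \<Omega> f)"
proof -
  have "continuous_on \<Omega> (zext \<Omega> f)"
    using assms(4) by (rule continuous_on_eq) (simp add: zext_def)
  moreover have "continuous_on (- K) (zext \<Omega> f)"
    by (rule continuous_on_eq[of _ "\<lambda>_. 0"]) (use assms(5) in \<open>auto simp: zext_def\<close>)
  ultimately have "continuous_on (\<Omega> \<union> - K) (zext \<Omega> f)"
    using assms by (intro continuous_on_open_Un) auto
  moreover have "\<Omega> \<union> - K = UNIV" using assms(3) by auto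
  ultimately show ?thesis by simp
qed

lemma has_derivative_zext:
  fixes f :: "'a::real_normed_vector \<Rightarrow> real"
  assumes "open \<Omega>" "closed K" "K \<subseteq> \<Omega>" "\<And>x. x \<in> \<Omega> \<Longrightarrow> (f has_derivative f' x) (at x)"
    "\<And>x. x \<in> \<Omega> - K \<Longrightarrow> f x = 0"
  shows "(zext \<Omega> f has_derivative (\<lambda>v. if x \<in> \<Omega> then f' x v else 0)) (at x)"
proof (cases "x \<in> \<Omega>")
  case True
  have "(zext \<Omega> f has_derivative f' x) (at x)"
    using assms(4)[OF True] assms(1) True
    by (rule has_derivative_transform_within_open) (simp add: zext_def)
  then show ?thesis using True by simp
next
  case False
  have "((\<lambda>_. 0) has_derivative (\<lambda>_. 0)) (at x)" by simp
  then have "(zext \<Omega> f has_derivative (\<lambda>_. 0)) (at x)"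
    by (rule has_derivative_transform_within_open[where s="- K"]) 
      (use assms False in \<open>auto simp: zext_def\<close>)
  then show ?thesis using False by simp
qed

text \<open>Green's formula turns \<open>-\<integral> G(h) l\<close> into \<open>\<integral> G'(h) \<bar>\<nabla>h\<bar>\<^sup>2\<close>, without boundary terms because
  \<open>G(h)\<close> has compact support in \<open>\<Omega>\<close>. Since \<open>0 \<le> G' \<le> 1\<close>, this dominates the Dirichlet energy of
  \<open>G(h)\<close>, which in turn controls translations.\<close>

lemma truncated_energy_translation:
  fixes h l :: "real^'n::finite \<Rightarrow> real"
  assumes \<Omega>: "open \<Omega>" "bounded \<Omega>" and hl: "dirichlet_laplacian \<Omega> h l"
    and G: "\<And>s. (G has_real_derivative G' s) (at s)" "continuous_on UNIV G'"
      "\<And>s. 0 \<le> G' s" "\<And>s. G' s \<le> 1"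
    and \<epsilon>: "\<epsilon> > 0" "\<And>s. \<bar>s\<bar> < \<epsilon> \<Longrightarrow> G s = 0" "\<And>s. \<bar>s\<bar> < \<epsilon> \<Longrightarrow> G' s = 0"
  shows "(\<integral>x. (zext \<Omega> (\<lambda>x. G (h x)) (x + v) - zext \<Omega> (\<lambda>x. G (h x)) x)\<^sup>2 \<partial>lborel)
     \<le> (norm v)\<^sup>2 * (- (\<integral>x. zext \<Omega> (\<lambda>x. G (h x) * l x) x \<partial>lborel))"
proof -
  from hl obtain d D where h: "continuous_on (closure \<Omega>) h" "\<And>x. x \<in> frontier \<Omega> \<Longrightarrow> h x = 0"
    and d: "\<And>x. x \<in> \<Omega> \<Longrightarrow> (h has_derivative (\<lambda>v. d x \<bullet> v)) (at x)"
    and D: "\<And>x. x \<in> \<Omega> \<Longrightarrow> (d has_derivative D x) (at x)"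
      "\<And>i. continuous_on \<Omega> (\<lambda>x. D x (axis i 1) $ i)"
    and l: "\<And>x. x \<in> \<Omega> \<Longrightarrow> l x = (\<Sum>i\<in>UNIV. D x (axis i 1) $ i)"
    unfolding dirichlet_laplacian_def by blast
  \<comment> \<open>Outside the compact set \<open>K\<close> the truncation vanishes, so extending by zero across the
    boundary of \<open>\<Omega>\<close> preserves smoothness.\<close>
  define K where "K = {x \<in> closure \<Omega>. \<epsilon> \<le> \<bar>h x\<bar>}"
  have K: "closed K" "bounded K" "K \<subseteq> \<Omega>"
  proof -
    have "K = closure \<Omega> \<inter> (\<lambda>x. \<bar>h x\<bar>) -` {\<epsilon>..}" by (auto simp: K_def)
    then show "closed K"
      using continuous_closed_preimage[of "closure \<Omega>" "\<lambda>x. \<bar>h x\<bar>" "{\<epsilon>..}"] h(1)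
      by (auto intro: continuous_on_rabs)
    show "bounded K"
      using \<Omega>(2) by (auto intro: bounded_subset[of "closure \<Omega>"] simp: K_def)
    show "K \<subseteq> \<Omega>"
      using h(2) \<epsilon>(1) \<Omega>(1) by (force simp: K_def frontier_def interior_open)
  qed
  have off: "G (h x) = 0" "G' (h x) = 0" if "x \<in> \<Omega> - K" for x
    using that \<epsilon>(2,3)[of "h x"] closure_subset by (auto simp: K_def not_le)
  note glue = continuous_on_zext[OF \<Omega>(1) K(1) K(3)]
  have conth: "continuous_on \<Omega> h"
    using h(1) closure_subset by (rule continuous_on_subset)
  have contd: "continuous_on \<Omega> d"
    using D(1) has_derivative_continuous by (blast intro!: continuous_at_imp_continuous_on)
  have contG: "continuous_on \<Omega> (\<lambda>x. G (h x))"
    using G(1) by (intro continuous_on_compose2[OF _ conth, of UNIV])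
      (auto intro!: continuous_at_imp_continuous_on DERIV_isCont)
  have contG': "continuous_on \<Omega> (\<lambda>x. G' (h x))"
    using G(2) by (intro continuous_on_compose2[OF _ conth, of UNIV]) auto
  have Gh: "((\<lambda>x. G (h x)) has_derivative (\<lambda>v. G' (h x) * (d x \<bullet> v))) (at x)" if "x \<in> \<Omega>" for x
    using has_derivative_compose[OF d[OF that] G(1)[of "h x", unfolded has_field_derivative_def]] .
  define Dv where "Dv v = zext \<Omega> (\<lambda>x. G' (h x) * (d x \<bullet> v))" for v
  have contDv: "continuous_on UNIV (Dv v)" for v
    unfolding Dv_def using off by (intro glue continuous_intros contG' contd) auto
  define en where "en i = zext \<Omega> (\<lambda>x. G' (h x) * (d x $ i)\<^sup>2)" for i
  define bulk where "bulk i = zext \<Omega> (\<lambda>x. G (h x) * D x (axis i 1) $ i)" for i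
  have cont_en: "continuous_on UNIV (en i)" for i
    unfolding en_def using off by (intro glue continuous_intros contG' contd) auto
  have cont_bulk: "continuous_on UNIV (bulk i)" for i
    unfolding bulk_def using off by (intro glue continuous_intros contG D(2)) auto
  have outside: "en i x = 0" "bulk i x = 0" "Dv w x = 0" "zext \<Omega> (\<lambda>x. G (h x)) x = 0" if "x \<notin> K" for i x w
    using that off[of x] by (auto simp: en_def bulk_def zext_def Dv_def)
  have bs: "bounded_supp (en i)" "bounded_supp (bulk i)" "bounded_supp (Dv w)" for i w
    using outside by (auto intro!: bounded_supp_continuous[OF _ K(2)] cont_en cont_bulk contDv)
  \<comment> \<open>Integrate the \<open>i\<close>-th derivative of \<open>G(h) \<partial>\<^sub>ih\<close> for each \<open>i\<close>. Only the diagonal second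
    derivatives occur.\<close>
  have parts: "(\<integral>x. en i x \<partial>lborel) = - (\<integral>x. bulk i x \<partial>lborel)" for i
  proof -
    define F where "F = zext \<Omega> (\<lambda>x. G (h x) * d x $ i)"
    define F' where "F' x v = G (h x) * D x v $ i + G' (h x) * (d x \<bullet> v) * d x $ i" for x v
    have "((\<lambda>x. G (h x) * d x $ i) has_derivative F' x) (at x)" if "x \<in> \<Omega>" for x
      unfolding F'_def
      by (intro has_derivative_mult[OF Gh[OF that]] bounded_linear.has_derivative[OF bounded_linear_vec_nth] D(1) that)
    then have F: "(F has_derivative (\<lambda>v. if x \<in> \<Omega> then F' x v else 0)) (at x)" for x
      unfolding F_def using off by (intro has_derivative_zext[OF \<Omega>(1) K(1) K(3)]) auto
    have "(\<integral>x. en i x + bulk i x \<partial>lborel) = 0"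
    proof (rule integral_directional_derivative_zero[OF F])
      show "(if x \<in> \<Omega> then F' x (axis i 1) else 0) = en i x + bulk i x" for x
        by (simp add: F'_def en_def bulk_def zext_def inner_axis power2_eq_square)
      show "continuous_on UNIV (\<lambda>x. en i x + bulk i x)"
        by (intro continuous_intros cont_en cont_bulk)
      show "F x = 0" if "x \<notin> K" for x
        using that off[of x] by (auto simp: F_def zext_def)
    qed (use K outside in auto)
    then show ?thesis
      using bs[THEN integrable_bounded_supp] by simp
  qed
  have "(\<integral>x. (zext \<Omega> (\<lambda>x. G (h x)) (x + v) - zext \<Omega> (\<lambda>x. G (h x)) x)\<^sup>2 \<partial>lborel)
     \<le> (\<integral>x. (Dv v x)\<^sup>2 \<partial>lborel)"
  proof (rule integral_translation_difference_le)
    show "(zext \<Omega> (\<lambda>x. G (h x)) has_derivative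
       (\<lambda>v. if x \<in> \<Omega> then G' (h x) * (d x \<bullet> v) else 0)) (at x)" for x
      using off by (intro has_derivative_zext[OF \<Omega>(1) K(1) K(3)] Gh) auto
    show "(if x \<in> \<Omega> then G' (h x) * (d x \<bullet> v) else 0) = Dv v x" for x
      by (simp add: Dv_def zext_def)
  qed (use K(2) outside contDv in auto)
  also have "\<dots> \<le> (\<integral>x. (norm v)\<^sup>2 * (\<Sum>i\<in>UNIV. en i x) \<partial>lborel)"
  proof (rule integral_mono)
    show "(Dv v x)\<^sup>2 \<le> (norm v)\<^sup>2 * (\<Sum>i\<in>UNIV. en i x)" for x
    proof (cases "x \<in> \<Omega>")
      case True
      have "(Dv v x)\<^sup>2 = (G' (h x))\<^sup>2 * (d x \<bullet> v)\<^sup>2"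
        using True by (simp add: Dv_def zext_def power_mult_distrib)
      also have "\<dots> \<le> G' (h x) * ((d x \<bullet> d x) * (v \<bullet> v))"
        using G(3,4)[of "h x"] Cauchy_Schwarz_ineq[of "d x" v]
        by (intro mult_mono) (auto simp: power2_eq_square mult_left_le)
      also have "\<dots> = (norm v)\<^sup>2 * (\<Sum>i\<in>UNIV. en i x)"
        using True by (simp add: en_def zext_def inner_vec_def[of "d x"] sum_distrib_left power2_norm_eq_inner power2_eq_square[of "_ $ _"] ac_simps)
      finally show ?thesis .
    qed (simp add: Dv_def en_def zext_def)
  qed (intro integrable_mult_right Bochner_Integration.integrable_sum integrable_bounded_supp bs bounded_supp_intros)+
  also have "\<dots> = (norm v)\<^sup>2 * (\<Sum>i\<in>UNIV. \<integral>x. en i x \<partial>lborel)"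
    using bs[THEN integrable_bounded_supp] by simp
  also have "\<dots> = (norm v)\<^sup>2 * (- (\<integral>x. (\<Sum>i\<in>UNIV. bulk i x) \<partial>lborel))"
    using bs[THEN integrable_bounded_supp] by (simp add: parts sum_negf)
  also have "(\<lambda>x. \<Sum>i\<in>UNIV. bulk i x) = zext \<Omega> (\<lambda>x. G (h x) * l x)"
    by (auto simp: bulk_def zext_def l sum_distrib_left)
  finally show ?thesis .
qed

lemma dirichlet_laplacian_bounded_supp:
  assumes "open \<Omega>" "bounded \<Omega>" "dirichlet_laplacian \<Omega> h l"
  shows "bounded_supp (zext \<Omega> h)" "bounded_supp (zext \<Omega> l)"
  using assms by (auto simp: dirichlet_laplacian_def intro: bounded_supp_zext)

text \<open>Removes a truncation: \<open>\<bar>G n s\<bar> \<le> \<bar>s\<bar>\<close> supplies the dominating functions.\<close>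

lemma integral_zext_limit:
  fixes h l :: "'a::euclidean_space \<Rightarrow> real"
  assumes bs: "bounded_supp (zext \<Omega> h)" "bounded_supp (zext \<Omega> l)"
    and G: "\<And>n s. \<bar>G n s\<bar> \<le> \<bar>s\<bar>" "\<And>n. continuous_on UNIV (G n)" "\<And>s. (\<lambda>n. G n s) \<longlonglongrightarrow> g s"
  shows "(\<lambda>n. \<integral>x. zext \<Omega> (\<lambda>x. G n (h x) * l x) x \<partial>lborel) \<longlonglongrightarrow> (\<integral>x. zext \<Omega> (\<lambda>x. g (h x) * l x) x \<partial>lborel)"
    and "(\<lambda>n. \<integral>x. (zext \<Omega> (\<lambda>x. G n (h x)) (x + v) - zext \<Omega> (\<lambda>x. G n (h x)) x)\<^sup>2 \<partial>lborel)
      \<longlonglongrightarrow> (\<integral>x. (zext \<Omega> (\<lambda>x. g (h x)) (x + v) - zext \<Omega> (\<lambda>x. g (h x)) x)\<^sup>2 \<partial>lborel)"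
proof -
  have G0: "G n 0 = 0" for n using G(1)[of n 0] by simp
  have g0: "g 0 = 0" using G(3)[of 0] by (simp add: G0 LIMSEQ_const_iff)
  have eq: "zext \<Omega> (\<lambda>x. G n (h x)) = (\<lambda>x. G n (zext \<Omega> h x))" 
    "zext \<Omega> (\<lambda>x. g (h x)) = (\<lambda>x. g (zext \<Omega> h x))" 
    "zext \<Omega> (\<lambda>x. G n (h x) * l x) = (\<lambda>x. G n (zext \<Omega> h x) * zext \<Omega> l x)" 
    "zext \<Omega> (\<lambda>x. g (h x) * l x) = (\<lambda>x. g (zext \<Omega> h x) * zext \<Omega> l x)" for n
    by (auto simp: zext_def G0 g0)
  note [measurable] = bs[THEN bounded_supp_measurable]
  have [measurable]: "G n \<in> borel_measurable borel" for n
    using G(2) by (rule borel_measurable_continuous_onI)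
  have [measurable]: "g \<in> borel_measurable borel"
    by (rule borel_measurable_LIMSEQ_real[of _ G]) (use G(3) in auto)
  show "(\<lambda>n. \<integral>x. zext \<Omega> (\<lambda>x. G n (h x) * l x) x \<partial>lborel) \<longlonglongrightarrow> (\<integral>x. zext \<Omega> (\<lambda>x. g (h x) * l x) x \<partial>lborel)"
    unfolding eq
  proof (rule integral_dominated_convergence[where w="\<lambda>x. \<bar>zext \<Omega> h x * zext \<Omega> l x\<bar>"])
    show "integrable lborel (\<lambda>x. \<bar>zext \<Omega> h x * zext \<Omega> l x\<bar>)"
      by (intro integrable_abs integrable_bounded_supp bounded_supp_intros bs)
    show "AE x in lborel. norm (G n (zext \<Omega> h x) * zext \<Omega> l x) \<le> \<bar>zext \<Omega> h x * zext \<Omega> l x\<bar>" for n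
      using G(1) by (auto simp: abs_mult intro!: mult_right_mono)
  qed (auto intro!: tendsto_intros G(3))
  show "(\<lambda>n. \<integral>x. (zext \<Omega> (\<lambda>x. G n (h x)) (x + v) - zext \<Omega> (\<lambda>x. G n (h x)) x)\<^sup>2 \<partial>lborel)
      \<longlonglongrightarrow> (\<integral>x. (zext \<Omega> (\<lambda>x. g (h x)) (x + v) - zext \<Omega> (\<lambda>x. g (h x)) x)\<^sup>2 \<partial>lborel)"
    unfolding eq
  proof (rule integral_dominated_convergence[where w="\<lambda>x. 2 * (zext \<Omega> h (x + v))\<^sup>2 + 2 * (zext \<Omega> h x)\<^sup>2"])
    show "integrable lborel (\<lambda>x. 2 * (zext \<Omega> h (x + v))\<^sup>2 + 2 * (zext \<Omega> h x)\<^sup>2)"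
      by (intro integrable_bounded_supp bounded_supp_intros bounded_supp_translate[OF bs(1)] bs)
    have "(G n a - G n b)\<^sup>2 \<le> 2 * a\<^sup>2 + 2 * b\<^sup>2" for n a b
    proof -
      have "(G n a)\<^sup>2 \<le> a\<^sup>2" "(G n b)\<^sup>2 \<le> b\<^sup>2"
        using G(1) by (auto simp: abs_le_square_iff)
      moreover have "(G n a - G n b)\<^sup>2 \<le> 2 * (G n a)\<^sup>2 + 2 * (G n b)\<^sup>2"
        using zero_le_power2[of "G n a + G n b"] by (simp add: power2_eq_square algebra_simps)
      ultimately show ?thesis by linarith
    qed
    then show "AE x in lborel. norm ((G n (zext \<Omega> h (x + v)) - G n (zext \<Omega> h x))\<^sup>2)
        \<le> 2 * (zext \<Omega> h (x + v))\<^sup>2 + 2 * (zext \<Omega> h x)\<^sup>2" for n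
      by auto
  qed (auto intro!: tendsto_intros G(3))
qed

lemma continuous_soft_pos: "\<epsilon> > 0 \<Longrightarrow> continuous_on S (soft_pos \<epsilon>)"
  using has_real_derivative_soft_pos DERIV_isCont by (blast intro: continuous_at_imp_continuous_on)

text \<open>The weak maximum principle, in the form \<open>\<integral> \<bar>\<nabla>h\<^sup>+\<bar>\<^sup>2 \<ge> 0\<close>.\<close>

lemma integral_positive_part_laplacian_nonpos:
  fixes h l :: "real^'n::finite \<Rightarrow> real"
  assumes \<Omega>: "open \<Omega>" "bounded \<Omega>" and hl: "dirichlet_laplacian \<Omega> h l"
  shows "(\<integral>x. zext \<Omega> (\<lambda>x. max 0 (h x) * l x) x \<partial>lborel) \<le> 0"
proof -
  \<comment> \<open>For a unit vector the translation estimate alone already gives the sign, as its left side is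
    a square.\<close>
  define v :: "real^'n" where "v = axis undefined 1"
  have "(\<integral>x. zext \<Omega> (\<lambda>x. soft_pos (1 / real (Suc n)) (h x) * l x) x \<partial>lborel) \<le> 0" for n
  proof -
    define e where "e = 1 / real (Suc n)"
    have e: "e > 0" by (simp add: e_def)
    have "0 \<le> (\<integral>x. (zext \<Omega> (\<lambda>x. soft_pos e (h x)) (x + v) - zext \<Omega> (\<lambda>x. soft_pos e (h x)) x)\<^sup>2 \<partial>lborel)"
      by (intro Bochner_Integration.integral_nonneg) auto
    also have "\<dots> \<le> (norm v)\<^sup>2 * (- (\<integral>x. zext \<Omega> (\<lambda>x. soft_pos e (h x) * l x) x \<partial>lborel))"
      using e by (intro truncated_energy_translation[OF \<Omega> hl has_real_derivative_soft_pos
            continuous_soft_pos_deriv soft_pos_deriv_bounds e]) (auto simp: soft_pos_def soft_pos_deriv_def)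
    finally show ?thesis by (simp add: e_def v_def)
  qed
  moreover have "(\<lambda>n. \<integral>x. zext \<Omega> (\<lambda>x. soft_pos (1 / real (Suc n)) (h x) * l x) x \<partial>lborel)
      \<longlonglongrightarrow> (\<integral>x. zext \<Omega> (\<lambda>x. max 0 (h x) * l x) x \<partial>lborel)"
  proof (rule integral_zext_limit(1)[OF dirichlet_laplacian_bounded_supp[OF \<Omega> hl]])
    show "\<bar>soft_pos (1 / real (Suc n)) s\<bar> \<le> \<bar>s\<bar>" for n s
      using soft_pos_bounds(1,2)[of "1 / real (Suc n)" s] by auto
  qed (auto intro!: continuous_soft_pos soft_pos_tendsto simp del: of_nat_Suc)
  ultimately show ?thesis
    by (intro LIMSEQ_le_const2) auto
qed

text \<open>Let the odd truncations \<open>soft_pos \<epsilon> s - soft_pos \<epsilon> (-s)\<close> tend to the identity.\<close>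

lemma integral_translation_le_dirichlet_energy:
  fixes h l :: "real^'n::finite \<Rightarrow> real"
  assumes \<Omega>: "open \<Omega>" "bounded \<Omega>" and hl: "dirichlet_laplacian \<Omega> h l"
  shows "(\<integral>x. (zext \<Omega> h (x + v) - zext \<Omega> h x)\<^sup>2 \<partial>lborel)
     \<le> (norm v)\<^sup>2 * (- (\<integral>x. zext \<Omega> (\<lambda>x. h x * l x) x \<partial>lborel))"
proof -
  define G where "G n s = soft_pos (1 / real (Suc n)) s - soft_pos (1 / real (Suc n)) (- s)" for n s
  have Glim: "(\<lambda>n. G n s) \<longlonglongrightarrow> s" for s
  proof -
    have "(\<lambda>n. G n s) \<longlonglongrightarrow> max 0 s - max 0 (- s)"
      unfolding G_def by (intro tendsto_diff soft_pos_tendsto)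
    moreover have "max 0 s - max 0 (- s) = s" by auto
    ultimately show ?thesis by simp
  qed
  have Gabs: "\<bar>G n s\<bar> \<le> \<bar>s\<bar>" for n s
    using soft_pos_bounds(1,2)[of "1 / real (Suc n)" s] soft_pos_bounds(1,2)[of "1 / real (Suc n)" "- s"]
    by (auto simp: G_def simp del: of_nat_Suc)
  have Gcont: "continuous_on UNIV (G n)" for n
    unfolding G_def
    by (intro continuous_on_diff continuous_soft_pos
        continuous_on_compose2[OF continuous_soft_pos continuous_on_minus[OF continuous_on_id]]) auto
  have "(\<integral>x. (zext \<Omega> (\<lambda>x. G n (h x)) (x + v) - zext \<Omega> (\<lambda>x. G n (h x)) x)\<^sup>2 \<partial>lborel)
     \<le> (norm v)\<^sup>2 * (- (\<integral>x. zext \<Omega> (\<lambda>x. G n (h x) * l x) x \<partial>lborel))" for n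
  proof -
    define e where "e = 1 / real (Suc n)"
    define G' where "G' s = soft_pos_deriv e s + soft_pos_deriv e (- s)" for s
    have e: "e > 0" by (simp add: e_def)
    have G: "G n s = soft_pos e s - soft_pos e (- s)" for s
      by (simp add: G_def e_def)
    have deriv: "(G n has_real_derivative G' s) (at s)" for s
    proof -
      have "((\<lambda>s. soft_pos e (- s)) has_real_derivative soft_pos_deriv e (- s) * (- 1)) (at s)"
        by (rule DERIV_chain2[where f="soft_pos e" and g=uminus])
          (auto intro!: has_real_derivative_soft_pos e derivative_eq_intros)
      from DERIV_diff[OF has_real_derivative_soft_pos[OF e] this] show ?thesis
        by (simp add: G'_def G[abs_def])
    qed
    have cont: "continuous_on UNIV G'"
      unfolding G'_def
      by (intro continuous_on_add continuous_soft_pos_deriv[OF e]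
          continuous_on_compose2[OF continuous_soft_pos_deriv[OF e] continuous_on_minus[OF continuous_on_id]]) auto
    have bounds: "0 \<le> G' s" "G' s \<le> 1" for s
      using e soft_pos_deriv_bounds[OF e, of s] soft_pos_deriv_bounds[OF e, of "- s"]
      by (simp_all add: G'_def soft_pos_deriv_def split: if_splits)
    have zero: "G n s = 0" "G' s = 0" if "\<bar>s\<bar> < e" for s
      using that by (auto simp: G G'_def soft_pos_def soft_pos_deriv_def)
    show ?thesis
      by (rule truncated_energy_translation[OF \<Omega> hl deriv cont bounds e zero])
  qed
  note energy = this
  note bs = dirichlet_laplacian_bounded_supp[OF \<Omega> hl]
  have "(\<lambda>n. (norm v)\<^sup>2 * (- (\<integral>x. zext \<Omega> (\<lambda>x. G n (h x) * l x) x \<partial>lborel)))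
      \<longlonglongrightarrow> (norm v)\<^sup>2 * (- (\<integral>x. zext \<Omega> (\<lambda>x. h x * l x) x \<partial>lborel))"
    by (rule tendsto_mult[OF tendsto_const tendsto_minus[OF integral_zext_limit(1)[OF bs Gabs Gcont Glim]]])
  from LIMSEQ_le[OF integral_zext_limit(2)[OF bs Gabs Gcont Glim] this] energy
  show ?thesis by blast
qed

section \<open>Square-integrable functions\<close>

lemma L2_measurable: "L2 \<Omega> f \<Longrightarrow> f \<in> borel_measurable (lebesgue_on \<Omega>)"
  by (simp add: L2_def)

lemma L2_square_integrable: "L2 \<Omega> f \<Longrightarrow> integrable (lebesgue_on \<Omega>) (\<lambda>x. (f x)\<^sup>2)"
  by (simp add: L2_def)

lemma integrable_L2_mult:
  assumes "L2 \<Omega> f" "L2 \<Omega> g"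
  shows "integrable (lebesgue_on \<Omega>) (\<lambda>x. f x * g x)"
proof (rule Bochner_Integration.integrable_bound)
  show "integrable (lebesgue_on \<Omega>) (\<lambda>x. (f x)\<^sup>2 + (g x)\<^sup>2)"
    using assms by (simp add: L2_def)
  show "(\<lambda>x. f x * g x) \<in> borel_measurable (lebesgue_on \<Omega>)"
    using assms[THEN L2_measurable] by (rule borel_measurable_times)
  have "\<bar>a * b\<bar> \<le> a\<^sup>2 + b\<^sup>2" for a b :: real
  proof -
    have "2 * (\<bar>a\<bar> * \<bar>b\<bar>) \<le> a\<^sup>2 + b\<^sup>2"
      using sum_squares_bound[of "\<bar>a\<bar>" "\<bar>b\<bar>"] by simp
    moreover have "0 \<le> \<bar>a\<bar> * \<bar>b\<bar>" by simp
    ultimately show ?thesis unfolding abs_mult by linarith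
  qed
  then show "AE x in lebesgue_on \<Omega>. norm (f x * g x) \<le> norm ((f x)\<^sup>2 + (g x)\<^sup>2)"
    by (auto intro: order_trans[OF _ abs_ge_self])
qed

lemma L2_cmult: "L2 \<Omega> f \<Longrightarrow> L2 \<Omega> (\<lambda>x. c * f x)"
  using borel_measurable_times[OF borel_measurable_const L2_measurable] L2_square_integrable
  by (auto simp: L2_def power_mult_distrib)

lemma L2_add:
  assumes "L2 \<Omega> f" "L2 \<Omega> g"
  shows "L2 \<Omega> (\<lambda>x. f x + g x)"
  unfolding L2_def
proof
  show "(\<lambda>x. f x + g x) \<in> borel_measurable (lebesgue_on \<Omega>)"
    using assms[THEN L2_measurable] by (rule borel_measurable_add)
  have "integrable (lebesgue_on \<Omega>) (\<lambda>x. (f x)\<^sup>2 + (g x)\<^sup>2 + 2 * (f x * g x))"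
    using assms[THEN L2_square_integrable] integrable_L2_mult[OF assms]
    by (intro Bochner_Integration.integrable_add integrable_mult_right) auto
  then show "integrable (lebesgue_on \<Omega>) (\<lambda>x. (f x + g x)\<^sup>2)"
    by (simp add: power2_sum mult.assoc)
qed

lemma L2_diff: "L2 \<Omega> f \<Longrightarrow> L2 \<Omega> g \<Longrightarrow> L2 \<Omega> (\<lambda>x. f x - g x)"
  using L2_add[of \<Omega> f "\<lambda>x. -1 * g x"] L2_cmult[of \<Omega> g "-1"] by simp

lemma L2_sum: "(\<And>i. i \<in> I \<Longrightarrow> L2 \<Omega> (f i)) \<Longrightarrow> L2 \<Omega> (\<lambda>x. \<Sum>i\<in>I. f i x)"
proof (induction I rule: infinite_finite_induct)
  case (insert i I)
  then show ?case by (simp add: L2_add)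
qed (simp_all add: L2_def)

lemma L2_mono:
  assumes "L2 \<Omega> f" "g \<in> borel_measurable (lebesgue_on \<Omega>)" "\<And>x. \<bar>g x\<bar> \<le> \<bar>f x\<bar>"
  shows "L2 \<Omega> g"
  unfolding L2_def
proof
  have "(g x)\<^sup>2 \<le> (f x)\<^sup>2" for x
    using assms(3) by (simp add: abs_le_square_iff)
  then show "integrable (lebesgue_on \<Omega>) (\<lambda>x. (g x)\<^sup>2)"
    using assms(2)
    by (intro Bochner_Integration.integrable_bound[OF L2_square_integrable[OF assms(1)]]) auto
qed (rule assms(2))

lemma L2_inner_commute: "L2_inner \<Omega> f g = L2_inner \<Omega> g f"
  by (simp add: L2_inner_def mult.commute)

lemma L2_inner_diff_left:
  "L2 \<Omega> f \<Longrightarrow> L2 \<Omega> g \<Longrightarrow> L2 \<Omega> h \<Longrightarrow> L2_inner \<Omega> (\<lambda>x. f x - g x) h = L2_inner \<Omega> f h - L2_inner \<Omega> g h"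
  by (simp add: L2_inner_def left_diff_distrib integrable_L2_mult)

lemma L2_inner_cmult_left: "L2_inner \<Omega> (\<lambda>x. c * f x) h = c * L2_inner \<Omega> f h"
  by (simp add: L2_inner_def mult.assoc)

lemma L2_inner_sum_left:
  assumes "\<And>i. i \<in> I \<Longrightarrow> L2 \<Omega> (f i)" "L2 \<Omega> h"
  shows "L2_inner \<Omega> (\<lambda>x. \<Sum>i\<in>I. f i x) h = (\<Sum>i\<in>I. L2_inner \<Omega> (f i) h)"
  unfolding L2_inner_def sum_distrib_right
  by (intro Bochner_Integration.integral_sum integrable_L2_mult assms)

lemma L2_inner_diff_self:
  assumes "L2 \<Omega> f" "L2 \<Omega> g"
  shows "L2_inner \<Omega> (\<lambda>x. f x - g x) (\<lambda>x. f x - g x) = L2_inner \<Omega> f f - 2 * L2_inner \<Omega> f g + L2_inner \<Omega> g g"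
proof -
  have right: "L2_inner \<Omega> h (\<lambda>x. f x - g x) = L2_inner \<Omega> f h - L2_inner \<Omega> g h" if "L2 \<Omega> h" for h
    using L2_inner_diff_left[OF assms that] by (simp add: L2_inner_commute[of \<Omega> h])
  have "L2_inner \<Omega> (\<lambda>x. f x - g x) (\<lambda>x. f x - g x)
      = L2_inner \<Omega> f (\<lambda>x. f x - g x) - L2_inner \<Omega> g (\<lambda>x. f x - g x)"
    by (intro L2_inner_diff_left L2_diff assms)
  then show ?thesis
    using assms by (simp add: right L2_inner_commute[of \<Omega> g f])
qed

lemma L2_inner_self_nonneg: "0 \<le> L2_inner \<Omega> f f"
  by (auto simp: L2_inner_def intro!: Bochner_Integration.integral_nonneg)

lemma L2_inner_mono:
  assumes "L2 \<Omega> f" "L2 \<Omega> g" "L2 \<Omega> h" "L2 \<Omega> k" "AE x in lebesgue_on \<Omega>. f x * g x \<le> h x * k x"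
  shows "L2_inner \<Omega> f g \<le> L2_inner \<Omega> h k"
  unfolding L2_inner_def using assms by (intro integral_mono_AE integrable_L2_mult) auto

lemma L2_Cauchy_Schwarz:
  assumes "L2 \<Omega> f" "L2 \<Omega> g"
  shows "\<bar>L2_inner \<Omega> f g\<bar> \<le> sqrt (L2_inner \<Omega> f f) * sqrt (L2_inner \<Omega> g g)"
proof -
  define A B C where "A = L2_inner \<Omega> f f" and "B = L2_inner \<Omega> f g" and "C = L2_inner \<Omega> g g"
  have quad: "0 \<le> A - 2 * t * B + t\<^sup>2 * C" for t
    using L2_inner_self_nonneg[of \<Omega> "\<lambda>x. f x - t * g x"] L2_inner_diff_self[OF assms(1) L2_cmult[OF assms(2), of t]]
      L2_inner_cmult_left[of \<Omega> t g] L2_inner_commute[of \<Omega> f "\<lambda>x. t * g x"] L2_inner_commute[of \<Omega> g "\<lambda>x. t * g x"]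
      L2_inner_commute[of \<Omega> f g]
    by (simp add: A_def B_def C_def power2_eq_square)
  have pos: "0 \<le> A" "0 \<le> C" by (simp_all add: A_def C_def L2_inner_self_nonneg)
  have "B\<^sup>2 \<le> A * C"
  proof (cases "C = 0")
    case True
    have "B = 0"
    proof (rule ccontr)
      assume "B \<noteq> 0"
      then show False using quad[of "(A + 1) / (2 * B)"] True by simp
    qed
    then show ?thesis using True by simp
  next
    case False
    then show ?thesis
      using quad[of "B / C"] pos by (simp add: field_simps power2_eq_square)
  qed
  then have "\<bar>B\<bar> \<le> sqrt (A * C)"
    by (simp add: real_le_rsqrt)
  then show ?thesis by (simp add: A_def B_def C_def real_sqrt_mult)
qed

text \<open>Norm convergence implies weak convergence, by Cauchy-Schwarz.\<close>

lemma L2_sums_inner: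
  assumes "L2_sums \<Omega> g f" "L2 \<Omega> h"
  shows "(\<lambda>N. \<Sum>k<N. L2_inner \<Omega> (g k) h) \<longlonglongrightarrow> L2_inner \<Omega> f h"
proof -
  define e where "e N x = f x - (\<Sum>k<N. g k x)" for N x
  have f: "L2 \<Omega> f" and g: "L2 \<Omega> (g k)" for k
    using assms(1) by (simp_all add: L2_sums_def)
  have e: "L2 \<Omega> (e N)" for N
    unfolding e_def by (intro L2_diff[OF f] L2_sum g)
  have "L2_inner \<Omega> (e N) (e N) = (\<integral>x. (f x - (\<Sum>k<N. g k x))\<^sup>2 \<partial>lebesgue_on \<Omega>)" for N
    by (simp only: L2_inner_def e_def power2_eq_square)
  then have "(\<lambda>N. L2_inner \<Omega> (e N) (e N)) \<longlonglongrightarrow> 0"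
    using assms(1) by (simp only: L2_sums_def)
  from tendsto_mult[OF tendsto_real_sqrt[OF this] tendsto_const]
  have lim: "(\<lambda>N. sqrt (L2_inner \<Omega> (e N) (e N)) * sqrt (L2_inner \<Omega> h h)) \<longlonglongrightarrow> 0"
    by (simp only: real_sqrt_zero mult_zero_left)
  have "(\<lambda>N. L2_inner \<Omega> (e N) h) \<longlonglongrightarrow> 0"
    by (rule Lim_null_comparison[OF _ lim])
      (intro always_eventually allI, simp only: real_norm_def L2_Cauchy_Schwarz[OF e assms(2)])
  from tendsto_diff[OF tendsto_const this, of "L2_inner \<Omega> f h"]
  have "(\<lambda>N. L2_inner \<Omega> f h - L2_inner \<Omega> (e N) h) \<longlonglongrightarrow> L2_inner \<Omega> f h"
    by (simp only: diff_zero)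
  moreover have "L2_inner \<Omega> f h - L2_inner \<Omega> (e N) h = (\<Sum>k<N. L2_inner \<Omega> (g k) h)" for N
  proof -
    have "L2_inner \<Omega> (e N) h = L2_inner \<Omega> f h - L2_inner \<Omega> (\<lambda>x. \<Sum>k<N. g k x) h"
      unfolding e_def by (intro L2_inner_diff_left f L2_sum g assms)
    also have "L2_inner \<Omega> (\<lambda>x. \<Sum>k<N. g k x) h = (\<Sum>k<N. L2_inner \<Omega> (g k) h)"
      by (intro L2_inner_sum_left g assms)
    finally show ?thesis by simp
  qed
  ultimately show ?thesis by (simp only:)
qed

lemma integral_lebesgue_on_zext:
  fixes q :: "'a::euclidean_space \<Rightarrow> real"
  assumes "open \<Omega>" "zext \<Omega> q \<in> borel_measurable borel"
  shows "integral\<^sup>L (lebesgue_on \<Omega>) q = integral\<^sup>L lborel (zext \<Omega> q)"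
proof -
  have "integral\<^sup>L (lebesgue_on \<Omega>) q = integral\<^sup>L lebesgue (\<lambda>x. indicator \<Omega> x *\<^sub>R q x)"
    using assms(1) by (subst integral_restrict_space) auto
  also have "(\<lambda>x. indicator \<Omega> x *\<^sub>R q x) = zext \<Omega> q"
    by (auto simp: zext_def indicator_def)
  also have "integral\<^sup>L lebesgue (zext \<Omega> q) = integral\<^sup>L lborel (zext \<Omega> q)"
    using assms(2) by (subst integral_completion) auto
  finally show ?thesis .
qed

lemma L2_continuous:
  fixes f :: "real^'n::finite \<Rightarrow> real"
  assumes "open \<Omega>" "bounded \<Omega>" "continuous_on (closure \<Omega>) f"
  shows "L2 \<Omega> f"
proof -
  have bs: "bounded_supp (zext \<Omega> f)" "bounded_supp (\<lambda>x. (zext \<Omega> f x)\<^sup>2)"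
    using assms by (auto intro!: bounded_supp_zext bounded_supp_intros)
  have eq: "(\<lambda>x. indicator \<Omega> x *\<^sub>R f x) = zext \<Omega> f" "(\<lambda>x. indicator \<Omega> x *\<^sub>R (f x)\<^sup>2) = (\<lambda>x. (zext \<Omega> f x)\<^sup>2)"
    by (auto simp: zext_def indicator_def)
  have "f \<in> borel_measurable (lebesgue_on \<Omega>)"
    using bounded_supp_measurable[OF bs(1)] assms(1) eq(1)
    by (subst borel_measurable_restrict_space_iff) (auto intro: measurable_completion)
  moreover have "integrable (lebesgue_on \<Omega>) (\<lambda>x. (f x)\<^sup>2)"
    using assms(1) integrable_bounded_supp[OF bs(2)] bounded_supp_measurable[OF bs(2)] eq(2)
    by (subst integrable_restrict_space) (auto simp: integrable_completion)
  ultimately show ?thesis by (simp add: L2_def)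
qed

lemma L2_inner_eq_lborel:
  fixes f g :: "real^'n::finite \<Rightarrow> real"
  assumes "open \<Omega>" "bounded \<Omega>" "continuous_on (closure \<Omega>) f" "continuous_on (closure \<Omega>) g"
  shows "L2_inner \<Omega> f g = (\<integral>x. zext \<Omega> (\<lambda>x. f x * g x) x \<partial>lborel)"
  unfolding L2_inner_def using assms
  by (intro integral_lebesgue_on_zext bounded_supp_measurable bounded_supp_zext continuous_intros)

section \<open>Linear combinations and classical derivatives\<close>

lemma dirichlet_laplacian_cmult:
  assumes "dirichlet_laplacian \<Omega> h l"
  shows "dirichlet_laplacian \<Omega> (\<lambda>x. c * h x) (\<lambda>x. c * l x)"
proof -
  obtain d D where d: "\<And>x. x \<in> \<Omega> \<Longrightarrow> (h has_derivative (\<lambda>v. d x \<bullet> v)) (at x)"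
      "\<And>x. x \<in> \<Omega> \<Longrightarrow> (d has_derivative D x) (at x)"
      "\<And>i. continuous_on \<Omega> (\<lambda>x. D x (axis i 1) $ i)"
      "\<And>x. x \<in> \<Omega> \<Longrightarrow> l x = (\<Sum>i\<in>UNIV. D x (axis i 1) $ i)"
    using assms unfolding dirichlet_laplacian_def by blast
  have "\<exists>d D. (\<forall>x\<in>\<Omega>. ((\<lambda>x. c * h x) has_derivative (\<lambda>v. d x \<bullet> v)) (at x)) \<and>
            (\<forall>x\<in>\<Omega>. (d has_derivative D x) (at x)) \<and>
            (\<forall>i. continuous_on \<Omega> (\<lambda>x. D x (axis i 1) $ i)) \<and>
            (\<forall>x\<in>\<Omega>. c * l x = (\<Sum>i\<in>UNIV. D x (axis i 1) $ i))"
  proof (intro exI conjI ballI allI)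
    show "((\<lambda>x. c * h x) has_derivative (\<lambda>v. (c *\<^sub>R d x) \<bullet> v)) (at x)" if "x \<in> \<Omega>" for x
      using has_derivative_mult_right[OF d(1)[OF that], of c] by simp
    show "((\<lambda>x. c *\<^sub>R d x) has_derivative (\<lambda>v. c *\<^sub>R D x v)) (at x)" if "x \<in> \<Omega>" for x
      using d(2)[OF that] by (rule has_derivative_scaleR_right)
    show "continuous_on \<Omega> (\<lambda>x. (c *\<^sub>R D x (axis i 1)) $ i)" for i
      using d(3)[of i] by (simp add: continuous_on_mult_left)
    show "c * l x = (\<Sum>i\<in>UNIV. (c *\<^sub>R D x (axis i 1)) $ i)" if "x \<in> \<Omega>" for x
      using d(4)[OF that] by (simp add: sum_distrib_left)
  qed
  then show ?thesis
    using assms unfolding dirichlet_laplacian_def by (auto intro!: continuous_intros)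
qed

lemma dirichlet_laplacian_add:
  assumes "dirichlet_laplacian \<Omega> h l" "dirichlet_laplacian \<Omega> h' l'"
  shows "dirichlet_laplacian \<Omega> (\<lambda>x. h x + h' x) (\<lambda>x. l x + l' x)"
proof -
  obtain d D where d: "\<And>x. x \<in> \<Omega> \<Longrightarrow> (h has_derivative (\<lambda>v. d x \<bullet> v)) (at x)"
      "\<And>x. x \<in> \<Omega> \<Longrightarrow> (d has_derivative D x) (at x)"
      "\<And>i. continuous_on \<Omega> (\<lambda>x. D x (axis i 1) $ i)"
      "\<And>x. x \<in> \<Omega> \<Longrightarrow> l x = (\<Sum>i\<in>UNIV. D x (axis i 1) $ i)"
    using assms(1) unfolding dirichlet_laplacian_def by blast
  obtain d' D' where d': "\<And>x. x \<in> \<Omega> \<Longrightarrow> (h' has_derivative (\<lambda>v. d' x \<bullet> v)) (at x)"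
      "\<And>x. x \<in> \<Omega> \<Longrightarrow> (d' has_derivative D' x) (at x)"
      "\<And>i. continuous_on \<Omega> (\<lambda>x. D' x (axis i 1) $ i)"
      "\<And>x. x \<in> \<Omega> \<Longrightarrow> l' x = (\<Sum>i\<in>UNIV. D' x (axis i 1) $ i)"
    using assms(2) unfolding dirichlet_laplacian_def by blast
  have "\<exists>d D. (\<forall>x\<in>\<Omega>. ((\<lambda>x. h x + h' x) has_derivative (\<lambda>v. d x \<bullet> v)) (at x)) \<and>
            (\<forall>x\<in>\<Omega>. (d has_derivative D x) (at x)) \<and>
            (\<forall>i. continuous_on \<Omega> (\<lambda>x. D x (axis i 1) $ i)) \<and>
            (\<forall>x\<in>\<Omega>. l x + l' x = (\<Sum>i\<in>UNIV. D x (axis i 1) $ i))"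
  proof (intro exI conjI ballI allI)
    show "((\<lambda>x. h x + h' x) has_derivative (\<lambda>v. (d x + d' x) \<bullet> v)) (at x)" if "x \<in> \<Omega>" for x
      using has_derivative_add[OF d(1)[OF that] d'(1)[OF that]] by (simp add: inner_add_left)
    show "((\<lambda>x. d x + d' x) has_derivative (\<lambda>v. D x v + D' x v)) (at x)" if "x \<in> \<Omega>" for x
      using d(2)[OF that] d'(2)[OF that] by (rule has_derivative_add)
    show "continuous_on \<Omega> (\<lambda>x. (D x (axis i 1) + D' x (axis i 1)) $ i)" for i
      using d(3)[of i] d'(3)[of i] by (simp add: continuous_on_add)
    show "l x + l' x = (\<Sum>i\<in>UNIV. (D x (axis i 1) + D' x (axis i 1)) $ i)" if "x \<in> \<Omega>" for x
      using d(4)[OF that] d'(4)[OF that] by (simp add: sum.distrib)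
  qed
  then show ?thesis
    using assms unfolding dirichlet_laplacian_def by (auto intro!: continuous_intros)
qed

lemma dirichlet_laplacian_zero:
  fixes \<Omega> :: "(real^'n::finite) set"
  shows "dirichlet_laplacian \<Omega> (\<lambda>x. 0) (\<lambda>x. 0)"
proof -
  have "(\<bullet>) (0 :: real^'n) = (\<lambda>_. 0)" by (simp add: fun_eq_iff)
  then show ?thesis
    unfolding dirichlet_laplacian_def
    by (intro conjI ballI exI[of _ "\<lambda>_. 0"] exI[of _ "\<lambda>_ _. 0"]) auto
qed

lemma dirichlet_laplacian_sum:
  assumes "\<And>k. k \<in> I \<Longrightarrow> dirichlet_laplacian \<Omega> (h k) (l k)"
  shows "dirichlet_laplacian \<Omega> (\<lambda>x. \<Sum>k\<in>I. h k x) (\<lambda>x. \<Sum>k\<in>I. l k x)"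
  using assms
  by (induction I rule: infinite_finite_induct) (simp_all add: dirichlet_laplacian_zero dirichlet_laplacian_add)

lemma has_derivative_partials:
  fixes h :: "real^'n::finite \<Rightarrow> real"
  assumes "h differentiable (at x)"
  shows "(h has_derivative (\<lambda>v. (\<chi> i. partial i h x) \<bullet> v)) (at x)"
proof -
  have D: "(h has_derivative frechet_derivative h (at x)) (at x)"
    using assms frechet_derivative_works by blast
  have "frechet_derivative h (at x) v = (\<chi> i. partial i h x) \<bullet> v" for v
  proof -
    have "frechet_derivative h (at x) v = frechet_derivative h (at x) (\<Sum>i\<in>UNIV. v $ i *\<^sub>R axis i 1)"
      by (simp add: basis_expansion scalar_mult_eq_scaleR[symmetric])
    also have "\<dots> = (\<Sum>i\<in>UNIV. v $ i * partial i h x)"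
      using linear_frechet_derivative[OF assms]
      by (simp add: linear_sum linear_cmul partial_def)
    also have "\<dots> = (\<chi> i. partial i h x) \<bullet> v"
      by (simp add: inner_vec_def mult.commute)
    finally show ?thesis .
  qed
  then have "frechet_derivative h (at x) = (\<lambda>v. (\<chi> i. partial i h x) \<bullet> v)" by auto
  then show ?thesis using D by simp
qed

lemma Ck_on_2_dirichlet_laplacian:
  fixes h :: "real^'n::finite \<Rightarrow> real"
  assumes "Ck_on 2 \<Omega> h" "continuous_on (closure \<Omega>) h" "\<And>x. x \<in> frontier \<Omega> \<Longrightarrow> h x = 0"
    and l: "continuous_on (closure \<Omega>) l" "\<And>x. x \<in> \<Omega> \<Longrightarrow> l x = laplacian h x"
  shows "dirichlet_laplacian \<Omega> h l"
proof -
  have C2: "\<And>x. x \<in> \<Omega> \<Longrightarrow> h differentiable (at x)"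
    "\<And>x i. x \<in> \<Omega> \<Longrightarrow> partial i h differentiable (at x)"
    "\<And>i j. continuous_on \<Omega> (partial j (partial i h))"
    using assms(1) unfolding numeral_2_eq_2 Ck_on.simps by blast+
  define D where "D x v = (\<chi> i. frechet_derivative (partial i h) (at x) v)" for x v
  have der: "((\<lambda>x. \<chi> i. partial i h x) has_derivative D x) (at x)" if "x \<in> \<Omega>" for x
  proof (rule iffD2[OF has_derivative_componentwise_within], rule ballI)
    fix b :: "real^'n" assume "b \<in> Basis"
    then obtain i where b: "b = axis i 1"
      unfolding Basis_vec_def by auto
    have "(partial i h has_derivative frechet_derivative (partial i h) (at x)) (at x)"
      by (rule iffD1[OF frechet_derivative_works C2(2)[OF that]])
    then show "((\<lambda>x. (\<chi> i. partial i h x) \<bullet> b) has_derivative (\<lambda>v. D x v \<bullet> b)) (at x)"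
      unfolding b D_def inner_axis vec_lambda_beta inner_real_def mult_1_right .
  qed
  have diag: "D x (axis i 1) $ i = partial i (partial i h) x" for x i
    by (simp only: D_def partial_def vec_lambda_beta)
  show ?thesis
    unfolding dirichlet_laplacian_def
  proof (intro conjI ballI allI exI[of _ "\<lambda>x. \<chi> i. partial i h x"] exI[of _ D])
    show "l x = (\<Sum>i\<in>UNIV. D x (axis i 1) $ i)" if "x \<in> \<Omega>" for x
      by (simp only: l(2)[OF that] diag laplacian_def)
    show "continuous_on \<Omega> (\<lambda>x. D x (axis i 1) $ i)" for i
      unfolding diag by (rule C2(3))
  qed (use assms der has_derivative_partials[OF C2(1)] in blast)+
qed

section \<open>Eigenfunction expansions and translations\<close>

lemma integral_translation_difference_le_four:
  assumes "bounded_supp f"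
  shows "(\<integral>x. (f (x + v) - f x)\<^sup>2 \<partial>lborel) \<le> 4 * (\<integral>x. (f x)\<^sup>2 \<partial>lborel)"
proof -
  note bs = assms bounded_supp_translate[OF assms, of v]
  have sq: "(a - b)\<^sup>2 \<le> 2 * a\<^sup>2 + 2 * b\<^sup>2" for a b :: real
    using zero_le_power2[of "a + b"] by (simp add: power2_eq_square algebra_simps)
  have "(\<integral>x. (f (x + v) - f x)\<^sup>2 \<partial>lborel) \<le> (\<integral>x. 2 * (f (x + v))\<^sup>2 + 2 * (f x)\<^sup>2 \<partial>lborel)"
    by (intro integral_mono integrable_bounded_supp bounded_supp_intros bs sq)
  also have "\<dots> = 2 * (\<integral>x. (f (x + v))\<^sup>2 \<partial>lborel) + 2 * (\<integral>x. (f x)\<^sup>2 \<partial>lborel)"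
    using bs[THEN bounded_supp_power2, THEN integrable_bounded_supp] by simp
  also have "(\<integral>x. (f (x + v))\<^sup>2 \<partial>lborel) = (\<integral>x. (f x)\<^sup>2 \<partial>lborel)"
    using bounded_supp_measurable[OF bounded_supp_power2[OF assms]] by (rule integral_lborel_translate)
  finally show ?thesis by simp
qed

locale dirichlet_spectrum =
  fixes \<Omega> :: "(real^'n::finite) set" and \<phi> :: "nat \<Rightarrow> real^'n \<Rightarrow> real" and ev :: "nat \<Rightarrow> real"
  assumes open_dom: "open \<Omega>" and bounded_dom: "bounded \<Omega>"
    and eigenbasis: "dirichlet_eigenbasis \<Omega> \<phi> ev"
begin

definition coef :: "(real^'n \<Rightarrow> real) \<Rightarrow> nat \<Rightarrow> real" where
  "coef f k = L2_inner \<Omega> f (\<phi> k)"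

definition comb :: "(nat \<Rightarrow> real) \<Rightarrow> nat \<Rightarrow> real^'n \<Rightarrow> real" where
  "comb c N x = (\<Sum>k<N. c k * \<phi> k x)"

lemma eigenfunction:
  shows "Ck_on 2 \<Omega> (\<phi> k)" "continuous_on (closure \<Omega>) (\<phi> k)"
    "x \<in> \<Omega> \<Longrightarrow> - laplacian (\<phi> k) x = ev k * \<phi> k x" "x \<in> frontier \<Omega> \<Longrightarrow> \<phi> k x = 0"
    "L2_inner \<Omega> (\<phi> j) (\<phi> k) = (if j = k then 1 else 0)"
  using eigenbasis by (simp_all add: dirichlet_eigenbasis_def)

lemma L2_eigenfunction: "L2 \<Omega> (\<phi> k)"
  using open_dom bounded_dom eigenfunction(2) by (rule L2_continuous)

lemma dirichlet_laplacian_comb: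
  "dirichlet_laplacian \<Omega> (comb c N) (comb (\<lambda>k. - ev k * c k) N)"
proof -
  have eig: "dirichlet_laplacian \<Omega> (\<phi> k) (\<lambda>x. - ev k * \<phi> k x)" for k
  proof (rule Ck_on_2_dirichlet_laplacian)
    show "- ev k * \<phi> k x = laplacian (\<phi> k) x" if "x \<in> \<Omega>" for x
      using eigenfunction(3)[OF that, of k] by simp
  qed (auto intro!: eigenfunction continuous_intros)
  have "dirichlet_laplacian \<Omega> (\<lambda>x. \<Sum>k<N. c k * \<phi> k x) (\<lambda>x. \<Sum>k<N. c k * (- ev k * \<phi> k x))"
    by (intro dirichlet_laplacian_sum dirichlet_laplacian_cmult eig)
  moreover have "comb (\<lambda>k. - ev k * c k) N = (\<lambda>x. \<Sum>k<N. c k * (- ev k * \<phi> k x))"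
    by (auto simp: comb_def fun_eq_iff intro!: sum.cong)
  ultimately show ?thesis by (simp add: comb_def[abs_def])
qed

lemma continuous_comb: "continuous_on (closure \<Omega>) (comb c N)"
  using dirichlet_laplacian_comb[of c N] by (simp add: dirichlet_laplacian_def)

lemma L2_comb: "L2 \<Omega> (comb c N)"
  using open_dom bounded_dom continuous_comb by (rule L2_continuous)

lemma L2_inner_comb:
  assumes "L2 \<Omega> f"
  shows "L2_inner \<Omega> (comb c N) f = (\<Sum>k<N. c k * coef f k)"
  unfolding comb_def[abs_def] coef_def L2_inner_commute[of \<Omega> f]
  by (subst L2_inner_sum_left) (auto intro!: L2_cmult L2_eigenfunction assms simp: L2_inner_cmult_left)

lemma coef_comb: "coef (comb c N) k = (if k < N then c k else 0)"
  using L2_inner_comb[OF L2_eigenfunction, of c N k]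
  by (simp add: coef_def eigenfunction(5) if_distrib sum.delta cong: if_cong)

lemma L2_inner_comb_comb: "L2_inner \<Omega> (comb c N) (comb c' N) = (\<Sum>k<N. c k * c' k)"
  by (simp add: L2_inner_comb L2_comb coef_comb)

text \<open>The translation estimate for the single eigenfunction \<open>\<phi>\<^sub>k\<close>, whose Dirichlet energy is \<open>ev\<^sub>k\<close>,
  bounds \<open>ev\<^sub>k\<close> below by a square.\<close>

lemma eigenvalue_nonneg: "0 \<le> ev k"
proof -
  define v :: "real^'n" where "v = axis undefined 1"
  define c where "c j = (if j = k then 1 else (0::real))" for j
  define h where "h = comb c (Suc k)"
  define l where "l = comb (\<lambda>k. - ev k * c k) (Suc k)"
  have "0 \<le> (\<integral>x. (zext \<Omega> h (x + v) - zext \<Omega> h x)\<^sup>2 \<partial>lborel)"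
    by (intro Bochner_Integration.integral_nonneg) auto
  also have "\<dots> \<le> (norm v)\<^sup>2 * (- (\<integral>x. zext \<Omega> (\<lambda>x. h x * l x) x \<partial>lborel))"
    unfolding h_def l_def
    by (intro integral_translation_le_dirichlet_energy open_dom bounded_dom dirichlet_laplacian_comb)
  also have "(\<integral>x. zext \<Omega> (\<lambda>x. h x * l x) x \<partial>lborel) = L2_inner \<Omega> h l"
    unfolding h_def l_def
    by (intro L2_inner_eq_lborel[symmetric] open_dom bounded_dom continuous_comb)
  also have "\<dots> = - ev k"
    unfolding h_def l_def L2_inner_comb_comb by (simp add: c_def)
  finally show ?thesis by (simp add: v_def)
qed

lemma translation_comb:
  "(\<integral>x. (zext \<Omega> (comb c N) (x + v) - zext \<Omega> (comb c N) x)\<^sup>2 \<partial>lborel)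
     \<le> (norm v)\<^sup>2 * (\<Sum>k<N. ev k * (c k)\<^sup>2)"
proof -
  let ?l = "comb (\<lambda>k. - ev k * c k) N"
  have "(\<integral>x. zext \<Omega> (\<lambda>x. comb c N x * ?l x) x \<partial>lborel) = L2_inner \<Omega> (comb c N) ?l"
    by (intro L2_inner_eq_lborel[symmetric] open_dom bounded_dom continuous_comb)
  also have "\<dots> = - (\<Sum>k<N. ev k * (c k)\<^sup>2)"
    unfolding L2_inner_comb_comb sum_negf[symmetric]
    by (intro sum.cong) (auto simp: power2_eq_square)
  finally show ?thesis
    using integral_translation_le_dirichlet_energy[OF open_dom bounded_dom dirichlet_laplacian_comb, of c N v]
    by simp
qed

lemma parseval:
  assumes "L2 \<Omega> f" "L2 \<Omega> g"
  shows "(\<lambda>N. \<Sum>k<N. coef f k * coef g k) \<longlonglongrightarrow> L2_inner \<Omega> f g"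
proof -
  have "L2_sums \<Omega> (\<lambda>k x. coef f k * \<phi> k x) f"
    using eigenbasis assms(1) by (simp add: dirichlet_eigenbasis_def coef_def)
  from L2_sums_inner[OF this assms(2)] show ?thesis
    by (simp add: L2_inner_cmult_left coef_def L2_inner_commute[of \<Omega> g])
qed

text \<open>The squared \<open>L\<^sup>2\<close> distance from \<open>f\<close> to its \<open>N\<close>-th partial sum, in the form given by
  Pythagoras.\<close>

definition residual :: "(real^'n \<Rightarrow> real) \<Rightarrow> nat \<Rightarrow> real" where
  "residual f N = L2_inner \<Omega> f f - (\<Sum>k<N. (coef f k)\<^sup>2)"

lemma residual_eq:
  assumes "L2 \<Omega> f"
  shows "residual f N = L2_inner \<Omega> (\<lambda>x. comb (coef f) N x - f x) (\<lambda>x. comb (coef f) N x - f x)"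
  by (simp add: L2_inner_diff_self L2_comb assms L2_inner_comb_comb L2_inner_comb residual_def power2_eq_square)

lemma residual_tendsto_0:
  assumes "L2 \<Omega> f"
  shows "residual f \<longlonglongrightarrow> 0"
  using tendsto_diff[OF tendsto_const parseval[OF assms assms], of "L2_inner \<Omega> f f"]
  by (simp add: residual_def[abs_def] power2_eq_square)

lemma coef_L2_sums:
  assumes "L2_sums \<Omega> (\<lambda>k x. a k * \<phi> k x) f"
  shows "coef f j = a j"
proof -
  have "(\<lambda>N. \<Sum>k<N. L2_inner \<Omega> (\<lambda>x. a k * \<phi> k x) (\<phi> j)) \<longlonglongrightarrow> coef f j"
    unfolding coef_def by (intro L2_sums_inner assms L2_eigenfunction)
  moreover have "(\<Sum>k<N. L2_inner \<Omega> (\<lambda>x. a k * \<phi> k x) (\<phi> j)) = a j" if "N > j" for N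
    using that by (simp add: L2_inner_cmult_left eigenfunction(5) if_distrib sum.delta' cong: if_cong)
  then have "(\<lambda>N. \<Sum>k<N. L2_inner \<Omega> (\<lambda>x. a k * \<phi> k x) (\<phi> j)) \<longlonglongrightarrow> a j"
    by (intro tendsto_eventually eventually_sequentiallyI[of "Suc j"]) simp
  ultimately show ?thesis by (rule LIMSEQ_unique)
qed

text \<open>An interpolation between \<open>\<parallel>f(\<cdot> + v) - f\<parallel> \<le> 2\<parallel>f\<parallel>\<close> and the gradient bound: each mode
  uses the better of the two, and \<open>min(1, s\<^sup>2) \<le> s\<close> with \<open>s = \<bar>v\<bar>\<surd>ev\<^sub>k\<close> produces the square root
  of the eigenvalue.\<close>

lemma translation_half_energy:
  assumes f: "continuous_on (closure \<Omega>) f"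
    and E: "\<And>N. (\<Sum>k<N. sqrt (ev k) * (coef f k)\<^sup>2) \<le> E"
  shows "(\<integral>x. (zext \<Omega> f (x + v) - zext \<Omega> f x)\<^sup>2 \<partial>lborel) \<le> 8 * norm v * E"
proof -
  have L2f: "L2 \<Omega> f" using open_dom bounded_dom f by (rule L2_continuous)
  \<comment> \<open>The gradient bound is used for the low frequencies of a finite partial sum. All other modes
    and the tail beyond \<open>N\<close> go together into \<open>e\<close> and are estimated by the norm.\<close>
  define c where "c k = (if (norm v)\<^sup>2 * ev k \<le> 1 then coef f k else 0)" for k
  have "(\<integral>x. (zext \<Omega> f (x + v) - zext \<Omega> f x)\<^sup>2 \<partial>lborel) \<le> 8 * norm v * E + 8 * residual f N" for N
  proof -
    define g where "g = comb c N"
    define e where "e x = f x - g x" for x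
    have cont: "continuous_on (closure \<Omega>) g" "continuous_on (closure \<Omega>) e"
      unfolding e_def g_def by (intro continuous_intros continuous_comb f)+
    note bs = bounded_supp_zext[OF open_dom bounded_dom cont(1)] bounded_supp_zext[OF open_dom bounded_dom cont(2)]
      bounded_supp_zext[OF open_dom bounded_dom f]
    define dg where "dg x = zext \<Omega> g (x + v) - zext \<Omega> g x" for x
    define de where "de x = zext \<Omega> e (x + v) - zext \<Omega> e x" for x
    have bsd: "bounded_supp dg" "bounded_supp de"
      unfolding dg_def de_def by (intro bounded_supp_diff bounded_supp_translate bs)+
    have split: "zext \<Omega> f (x + v) - zext \<Omega> f x = dg x + de x" for x
      by (simp add: dg_def de_def e_def zext_def)
    have sq: "(a + b)\<^sup>2 \<le> 2 * a\<^sup>2 + 2 * b\<^sup>2" for a b :: real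
      using zero_le_power2[of "a - b"] by (simp add: power2_eq_square algebra_simps)
    have "(\<integral>x. (zext \<Omega> f (x + v) - zext \<Omega> f x)\<^sup>2 \<partial>lborel) \<le> (\<integral>x. 2 * (dg x)\<^sup>2 + 2 * (de x)\<^sup>2 \<partial>lborel)"
      unfolding split by (intro integral_mono integrable_bounded_supp bounded_supp_intros bsd sq)
    also have "\<dots> = 2 * (\<integral>x. (dg x)\<^sup>2 \<partial>lborel) + 2 * (\<integral>x. (de x)\<^sup>2 \<partial>lborel)"
      using bsd[THEN bounded_supp_power2, THEN integrable_bounded_supp] by simp
    also have "(\<integral>x. (dg x)\<^sup>2 \<partial>lborel) \<le> (norm v)\<^sup>2 * (\<Sum>k<N. ev k * (c k)\<^sup>2)"
      unfolding dg_def g_def by (rule translation_comb)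
    also have "(\<integral>x. (de x)\<^sup>2 \<partial>lborel) \<le> 4 * L2_inner \<Omega> e e"
    proof -
      have "(\<lambda>x. (zext \<Omega> e x)\<^sup>2) = zext \<Omega> (\<lambda>x. e x * e x)"
        by (auto simp: zext_def power2_eq_square)
      then have "(\<integral>x. (zext \<Omega> e x)\<^sup>2 \<partial>lborel) = L2_inner \<Omega> e e"
        using L2_inner_eq_lborel[OF open_dom bounded_dom cont(2) cont(2)] by simp
      then show ?thesis
        unfolding de_def using integral_translation_difference_le_four[OF bs(2), of v] by simp
    qed
    also have "L2_inner \<Omega> e e = residual f N + (\<Sum>k<N. (coef f k)\<^sup>2 - (c k)\<^sup>2)"
    proof -
      have "L2_inner \<Omega> e e = L2_inner \<Omega> f f - 2 * L2_inner \<Omega> f g + L2_inner \<Omega> g g"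
        unfolding e_def g_def by (intro L2_inner_diff_self L2f L2_comb)
      also have "L2_inner \<Omega> f g = (\<Sum>k<N. c k * coef f k)"
        unfolding g_def by (simp only: L2_inner_commute[of \<Omega> f] L2_inner_comb[OF L2f])
      also have "\<dots> = (\<Sum>k<N. (c k)\<^sup>2)"
        by (intro sum.cong) (auto simp: c_def power2_eq_square)
      also have "L2_inner \<Omega> g g = (\<Sum>k<N. (c k)\<^sup>2)"
        unfolding g_def L2_inner_comb_comb by (simp add: power2_eq_square)
      finally show ?thesis by (simp add: residual_def sum_subtractf)
    qed
    finally have "(\<integral>x. (zext \<Omega> f (x + v) - zext \<Omega> f x)\<^sup>2 \<partial>lborel)
        \<le> (\<Sum>k<N. 2 * ((norm v)\<^sup>2 * ev k) * (c k)\<^sup>2 + 8 * ((coef f k)\<^sup>2 - (c k)\<^sup>2)) + 8 * residual f N"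
      by (simp add: sum.distrib sum_distrib_left mult.assoc)
    also have "\<dots> \<le> (\<Sum>k<N. 8 * norm v * (sqrt (ev k) * (coef f k)\<^sup>2)) + 8 * residual f N"
    proof (intro add_right_mono sum_mono)
      fix k
      define s where "s = norm v * sqrt (ev k)"
      have s: "0 \<le> s" "(norm v)\<^sup>2 * ev k = s\<^sup>2"
        using eigenvalue_nonneg[of k] by (simp_all add: s_def power_mult_distrib)
      have "2 * s\<^sup>2 * (c k)\<^sup>2 + 8 * ((coef f k)\<^sup>2 - (c k)\<^sup>2) \<le> 8 * s * (coef f k)\<^sup>2"
      proof (cases "s\<^sup>2 \<le> 1")
        case True
        then have "s \<le> 1" using power2_le_imp_le[of s 1] by simp
        then have "2 * s\<^sup>2 \<le> 8 * s"
          using s(1) mult_left_le[of s s] by (simp add: power2_eq_square)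
        then show ?thesis
          using True by (simp add: c_def s(2) mult_right_mono)
      next
        case False
        then have "1 \<le> s" using s(1) power_le_one[of s 2] by (cases "s \<le> 1") auto
        then have "8 * 1 * (coef f k)\<^sup>2 \<le> 8 * s * (coef f k)\<^sup>2"
          by (intro mult_right_mono mult_left_mono) auto
        then show ?thesis
          using False by (simp add: c_def s(2))
      qed
      then show "2 * ((norm v)\<^sup>2 * ev k) * (c k)\<^sup>2 + 8 * ((coef f k)\<^sup>2 - (c k)\<^sup>2)
          \<le> 8 * norm v * (sqrt (ev k) * (coef f k)\<^sup>2)"
        by (simp add: s(2)) (simp add: s_def mult.assoc)
    qed
    also have "(\<Sum>k<N. 8 * norm v * (sqrt (ev k) * (coef f k)\<^sup>2)) \<le> 8 * norm v * E"
      unfolding sum_distrib_left[symmetric] by (intro mult_left_mono E) auto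
    finally show ?thesis by simp
  qed
  moreover have "(\<lambda>N. 8 * norm v * E + 8 * residual f N) \<longlonglongrightarrow> 8 * norm v * E + 8 * 0"
    by (intro tendsto_intros residual_tendsto_0 L2f)
  ultimately show ?thesis
    using LIMSEQ_le_const[of _ "8 * norm v * E + 8 * 0"] by fastforce
qed

end

section \<open>Positivity of resolvents and the energy of the negative part\<close>

text \<open>The truncated integral \<open>\<integral>\<^sub>0\<^sup>R x / (x + r\<^sup>2) dr\<close>, which tends to \<open>(\<pi>/2) \<surd>x\<close> as \<open>R\<close> grows.
  At \<open>x = 0\<close> the convention for division by zero gives the right value.\<close>

definition half_weight :: "real \<Rightarrow> real \<Rightarrow> real" where
  "half_weight R x = sqrt x * arctan (R / sqrt x)"

lemma has_integral_half_weight: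
  assumes "0 \<le> x" "0 \<le> R"
  shows "((\<lambda>r. x / (x + r\<^sup>2)) has_integral half_weight R x) {0..R}"
proof (cases "x = 0")
  case True
  then show ?thesis by (simp add: half_weight_def)
next
  case False
  then have x: "x > 0" using assms by simp
  have deriv: "((\<lambda>r. sqrt x * arctan (r / sqrt x)) has_real_derivative x / (x + r\<^sup>2)) (at r within {0..R})" for r
  proof -
    have "((\<lambda>r. sqrt x * arctan (r / sqrt x)) has_real_derivative
        sqrt x * (inverse (1 + (r / sqrt x)\<^sup>2) * (1 / sqrt x))) (at r within {0..R})"
      using x by (auto intro!: derivative_eq_intros simp: mult.assoc)
    also have "sqrt x * (inverse (1 + (r / sqrt x)\<^sup>2) * (1 / sqrt x)) = inverse (1 + r\<^sup>2 / x)"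
      using x by (simp add: power_divide)
    also have "\<dots> = x / (x + r\<^sup>2)"
      using x by (simp add: field_simps)
    finally show ?thesis .
  qed
  have "((\<lambda>r. x / (x + r\<^sup>2)) has_integral (sqrt x * arctan (R / sqrt x) - sqrt x * arctan (0 / sqrt x))) {0..R}"
    by (rule fundamental_theorem_of_calculus[OF assms(2)])
      (use deriv in \<open>simp add: has_real_derivative_iff_has_vector_derivative\<close>)
  then show ?thesis by (simp add: half_weight_def)
qed

lemma abs_arctan_le: "\<bar>arctan y\<bar> \<le> pi / 2"
  using arctan_bounded[of y] by linarith

lemma arctan_scaled_tendsto:
  assumes "x > 0"
  shows "(\<lambda>n. arctan (real n / x)) \<longlonglongrightarrow> pi / 2"
proof -
  have "filterlim (\<lambda>n. real n * inverse x) at_top sequentially"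
    using assms by (intro filterlim_at_top_mult_tendsto_pos[OF tendsto_const] filterlim_real_sequentially) auto
  then show ?thesis
    by (intro filterlim_compose[OF tendsto_arctan_at_top]) (simp add: divide_inverse)
qed

context dirichlet_spectrum
begin

text \<open>Up to an error that does not depend on \<open>s\<close>, this says \<open>\<langle>s(s - \<Delta>)\<^sup>-\<^sup>1 f, g\<rangle> \<ge> 0\<close>. A partial
  sum \<open>S\<close> of \<open>f\<close> need not be nonnegative, but testing \<open>(s - \<Delta>)v = sS\<close> with \<open>v\<^sup>-\<close> gives
  \<open>\<parallel>v\<^sup>-\<parallel> \<le> \<parallel>S - f\<parallel>\<close>, because \<open>S\<close> is that close to a nonnegative function.\<close>

lemma resolvent_positivity:
  assumes f: "L2 \<Omega> f" "\<And>x. 0 \<le> f x" and g: "L2 \<Omega> g" "\<And>x. 0 \<le> g x" and s: "0 < s"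
  shows "- (sqrt (residual f N) * sqrt (L2_inner \<Omega> g g)) \<le> (\<Sum>k<N. s / (ev k + s) * (coef f k * coef g k))"
proof -
  define c where "c k = s / (ev k + s) * coef f k" for k
  define S where "S = comb (coef f) N"
  define v where "v = comb c N"
  define vm where "vm x = max 0 (- v x)" for x
  define e where "e x = S x - f x" for x
  have contv: "continuous_on (closure \<Omega>) v" "continuous_on (closure \<Omega>) S"
    unfolding v_def S_def by (rule continuous_comb)+
  have contvm: "continuous_on (closure \<Omega>) vm"
    unfolding vm_def by (intro continuous_intros contv)
  have L2: "L2 \<Omega> v" "L2 \<Omega> S" "L2 \<Omega> vm" "L2 \<Omega> e"
    using L2_continuous[OF open_dom bounded_dom] contv contvm L2_diff[OF _ f(1)] by (auto simp: e_def[abs_def])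
  have res: "residual f N = L2_inner \<Omega> e e"
    unfolding e_def[abs_def] S_def by (rule residual_eq[OF f(1)])
  have "ev k * c k = s * (coef f k - c k)" for k
  proof -
    have "(ev k + s) * c k = s * coef f k"
      using s eigenvalue_nonneg[of k] by (simp add: c_def)
    then show ?thesis by (simp add: algebra_simps)
  qed
  then have "- ev k * (- c k) * y = s * (coef f k * y - c k * y)" for k y
    by (simp add: right_diff_distrib left_diff_distrib flip: mult.assoc)
  then have lap: "comb (\<lambda>k. - ev k * (- c k)) N x = s * (S x - v x)" for x
    by (simp only: comb_def S_def v_def sum_distrib_left sum_subtractf[symmetric])
  have neg: "comb (\<lambda>k. - c k) N x = - v x" for x
    by (simp add: comb_def v_def sum_negf)
  have "dirichlet_laplacian \<Omega> (\<lambda>x. - v x) (\<lambda>x. s * (S x - v x))"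
  proof -
    have "comb (\<lambda>k. - ev k * (- c k)) N = (\<lambda>x. s * (S x - v x))" "comb (\<lambda>k. - c k) N = (\<lambda>x. - v x)"
      using lap neg by blast+
    then show ?thesis using dirichlet_laplacian_comb[of "\<lambda>k. - c k" N] by (simp only:)
  qed
  from integral_positive_part_laplacian_nonpos[OF open_dom bounded_dom this]
  have "(\<integral>x. zext \<Omega> (\<lambda>x. vm x * (s * (S x - v x))) x \<partial>lborel) \<le> 0"
    by (simp add: vm_def)
  also have "(\<integral>x. zext \<Omega> (\<lambda>x. vm x * (s * (S x - v x))) x \<partial>lborel) = L2_inner \<Omega> vm (\<lambda>x. s * (S x - v x))"
    by (intro L2_inner_eq_lborel[symmetric] open_dom bounded_dom contvm continuous_intros contv)
  also have "\<dots> = s * (L2_inner \<Omega> S vm - L2_inner \<Omega> v vm)"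
    by (simp add: L2_inner_commute[of \<Omega> vm] L2_inner_cmult_left L2_inner_diff_left L2)
  finally have "L2_inner \<Omega> S vm \<le> L2_inner \<Omega> v vm"
    using s by (simp add: mult_le_0_iff)
  also have "L2_inner \<Omega> v vm = - L2_inner \<Omega> vm vm"
  proof -
    have "v x * vm x = - (vm x * vm x)" for x
      by (simp add: vm_def max_def)
    then show ?thesis by (simp add: L2_inner_def)
  qed
  finally have "L2_inner \<Omega> vm vm \<le> - L2_inner \<Omega> S vm" by simp
  also have "\<dots> \<le> - L2_inner \<Omega> e vm"
  proof -
    have "0 \<le> L2_inner \<Omega> f vm"
      unfolding L2_inner_def
      by (intro Bochner_Integration.integral_nonneg mult_nonneg_nonneg f) (simp add: vm_def)
    then show ?thesis
      by (simp add: e_def[abs_def] L2_inner_diff_left L2 f)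
  qed
  also have "\<dots> \<le> sqrt (L2_inner \<Omega> e e) * sqrt (L2_inner \<Omega> vm vm)"
    using L2_Cauchy_Schwarz[OF L2(4) L2(3)] by linarith
  finally have "sqrt (L2_inner \<Omega> vm vm) * sqrt (L2_inner \<Omega> vm vm) \<le> sqrt (L2_inner \<Omega> e e) * sqrt (L2_inner \<Omega> vm vm)"
    by (simp add: L2_inner_self_nonneg)
  then have vm_le: "sqrt (L2_inner \<Omega> vm vm) \<le> sqrt (L2_inner \<Omega> e e)"
  proof (cases "L2_inner \<Omega> vm vm = 0")
    case False
    then have "0 < sqrt (L2_inner \<Omega> vm vm)"
      using L2_inner_self_nonneg[of \<Omega> vm] by simp
    from mult_right_le_imp_le[OF _ this] show ?thesis
      using \<open>sqrt (L2_inner \<Omega> vm vm) * sqrt (L2_inner \<Omega> vm vm) \<le> _\<close> by blast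
  qed (simp add: L2_inner_self_nonneg)
  have "- (sqrt (residual f N) * sqrt (L2_inner \<Omega> g g)) \<le> - (sqrt (L2_inner \<Omega> vm vm) * sqrt (L2_inner \<Omega> g g))"
    using vm_le by (simp add: res mult_right_mono L2_inner_self_nonneg)
  also have "\<dots> \<le> - L2_inner \<Omega> vm g"
    using L2_Cauchy_Schwarz[OF L2(3) g(1)] by linarith
  also have "\<dots> \<le> L2_inner \<Omega> v g"
  proof -
    have "- 1 * vm x * g x \<le> v x * g x" for x
      using g(2)[of x] by (intro mult_right_mono) (auto simp: vm_def)
    then have "L2_inner \<Omega> (\<lambda>x. - 1 * vm x) g \<le> L2_inner \<Omega> v g"
      by (intro L2_inner_mono L2_cmult L2 g) auto
    then show ?thesis by (simp only: L2_inner_cmult_left)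
  qed
  also have "\<dots> = (\<Sum>k<N. s / (ev k + s) * (coef f k * coef g k))"
    unfolding v_def L2_inner_comb[OF g(1)] c_def by (simp add: mult.assoc)
  finally show ?thesis .
qed

text \<open>Integrate \<open>1 - s/(ev\<^sub>k + s)\<close> over \<open>s = r\<^sup>2\<close> for \<open>0 < r \<le> R\<close>. The error in
  \<open>resolvent_positivity\<close> is uniform in \<open>s\<close>, so it is merely multiplied by \<open>R\<close>. If \<open>f\<close> and \<open>g\<close> are
  orthogonal, the right side tends to zero with growing \<open>N\<close>.\<close>

lemma half_weight_disjoint:
  assumes f: "L2 \<Omega> f" "\<And>x. 0 \<le> f x" and g: "L2 \<Omega> g" "\<And>x. 0 \<le> g x"
    and R: "0 \<le> R"
  shows "(\<Sum>k<N. half_weight R (ev k) * (coef f k * coef g k))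
    \<le> R * ((\<Sum>k<N. coef f k * coef g k) + sqrt (residual f N) * sqrt (L2_inner \<Omega> g g))"
proof -
  define \<epsilon> where "\<epsilon> = (\<Sum>k<N. coef f k * coef g k) + sqrt (residual f N) * sqrt (L2_inner \<Omega> g g)"
  define W where "W r = (\<Sum>k<N. ev k / (ev k + r\<^sup>2) * (coef f k * coef g k))" for r
  have le: "W r \<le> \<epsilon>" if "r \<noteq> 0" for r
  proof -
    have r: "0 < r\<^sup>2" using that by simp
    have "ev k / (ev k + r\<^sup>2) = 1 - r\<^sup>2 / (ev k + r\<^sup>2)" for k
    proof -
      have "ev k + r\<^sup>2 \<noteq> 0" using r eigenvalue_nonneg[of k] by linarith
      then show ?thesis by (simp add: divide_simps)
    qed
    then have "W r = (\<Sum>k<N. coef f k * coef g k) - (\<Sum>k<N. r\<^sup>2 / (ev k + r\<^sup>2) * (coef f k * coef g k))"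
      by (simp add: W_def sum_subtractf[symmetric] left_diff_distrib)
    then show ?thesis
      using resolvent_positivity[OF f g r, of N] by (simp add: \<epsilon>_def)
  qed
  have "(W has_integral (\<Sum>k<N. half_weight R (ev k) * (coef f k * coef g k))) {0..R}"
    unfolding W_def by (intro has_integral_sum has_integral_mult_left has_integral_half_weight eigenvalue_nonneg R) auto
  \<comment> \<open>The resolvent bound is available only for \<open>r \<noteq> 0\<close>, so the integrand is changed at that point.\<close>
  from has_integral_spike_finite[OF _ _ this, of "{0}"]
  have "((\<lambda>r. if r = 0 then \<epsilon> else W r) has_integral (\<Sum>k<N. half_weight R (ev k) * (coef f k * coef g k))) {0..R}"
    by auto
  moreover have "((\<lambda>_. \<epsilon>) has_integral (R - 0) * \<epsilon>) {0..R}"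
    using has_integral_const_real[of \<epsilon> 0 R] R by simp
  ultimately show ?thesis
    unfolding \<epsilon>_def[symmetric]
    using has_integral_le[of "\<lambda>r. if r = 0 then \<epsilon> else W r" _ "{0..R}" "\<lambda>_. \<epsilon>"] le by auto
qed

lemma summable_coef_square: "L2 \<Omega> f \<Longrightarrow> summable (\<lambda>k. (coef f k)\<^sup>2)"
  using parseval[of f f] by (auto simp: summable_def sums_def power2_eq_square)

text \<open>With \<open>u = p - f\<close>, the form of \<open>A\<^sub>1\<^sub>/\<^sub>2\<close> at \<open>f\<close> equals its cross term between \<open>p\<close> and \<open>f\<close> minus
  \<open>\<langle>w, f\<rangle>\<close>, and the cross term is nonpositive. The square root is replaced by \<open>half_weight n\<close>
  because the cross term, unlike \<open>\<langle>w, f\<rangle>\<close>, is not yet known to converge; the number of modes tends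
  to infinity first, and then \<open>n\<close>.\<close>

lemma half_energy_negative_part:
  assumes u: "L2 \<Omega> u" and w: "L2 \<Omega> w" "\<And>k. coef w k = sqrt (ev k) * coef u k"
  defines "f \<equiv> \<lambda>x. max 0 (- u x)"
  shows "(\<Sum>k<K. sqrt (ev k) * (coef f k)\<^sup>2) \<le> - L2_inner \<Omega> w f"
proof -
  define p where "p x = max 0 (u x)" for x
  have meas_u: "u \<in> borel_measurable (lebesgue_on \<Omega>)"
    using u by (rule L2_measurable)
  have L2: "L2 \<Omega> f" "L2 \<Omega> p"
    unfolding f_def p_def
    by (rule L2_mono[OF u]; use meas_u in \<open>auto intro!: borel_measurable_max borel_measurable_uminus\<close>)+
  have nonneg: "0 \<le> f x" "0 \<le> p x" for x
    by (simp_all add: f_def p_def)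
  have coef_u: "coef u k = coef p k - coef f k" for k
  proof -
    have "u = (\<lambda>x. p x - f x)" by (auto simp: p_def f_def)
    then show ?thesis
      unfolding coef_def using L2_inner_diff_left[OF L2(2,1) L2_eigenfunction] by metis
  qed
  have disjoint: "L2_inner \<Omega> p f = 0"
  proof -
    have "(\<lambda>x. p x * f x) = (\<lambda>x. 0)" by (simp add: p_def f_def max_def fun_eq_iff)
    then show ?thesis by (simp only: L2_inner_def integral_zero)
  qed
  define t where "t k = coef w k * coef f k" for k
  have t: "t k = sqrt (ev k) * (coef u k * coef f k)" for k
    by (simp add: t_def w)
  have summable_t: "summable (\<lambda>k. \<bar>t k\<bar>)"
  proof (rule summable_comparison_test')
    show "summable (\<lambda>k. (coef w k)\<^sup>2 + (coef f k)\<^sup>2)"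
      by (intro summable_add summable_coef_square L2 w)
    show "norm \<bar>t k\<bar> \<le> (coef w k)\<^sup>2 + (coef f k)\<^sup>2" for k
    proof -
      have "2 * (\<bar>coef w k\<bar> * \<bar>coef f k\<bar>) \<le> (coef w k)\<^sup>2 + (coef f k)\<^sup>2"
        using sum_squares_bound[of "\<bar>coef w k\<bar>" "\<bar>coef f k\<bar>"] by simp
      moreover have "0 \<le> \<bar>coef w k\<bar> * \<bar>coef f k\<bar>" by simp
      ultimately show ?thesis
        unfolding t_def abs_mult real_norm_def abs_abs by linarith
    qed
  qed
  define th where "th n k = arctan (real n / sqrt (ev k))" for n k
  have th: "\<bar>th n k\<bar> \<le> pi / 2" "0 \<le> th n k" for n k
    unfolding th_def by (rule abs_arctan_le) (simp add: zero_le_arctan_iff eigenvalue_nonneg)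
  have th_t_le: "\<bar>th n k * t k\<bar> \<le> pi / 2 * \<bar>t k\<bar>" for n k
    unfolding abs_mult using th by (intro mult_right_mono) auto
  have bound: "(\<Sum>k<K. th n k * (sqrt (ev k) * (coef f k)\<^sup>2)) \<le> - (\<Sum>k. th n k * t k)" for n
  proof -
    define \<epsilon> where "\<epsilon> N = (\<Sum>k<N. coef p k * coef f k) + sqrt (residual p N) * sqrt (L2_inner \<Omega> f f)" for N
    have "\<epsilon> \<longlonglongrightarrow> L2_inner \<Omega> p f + sqrt 0 * sqrt (L2_inner \<Omega> f f)"
      unfolding \<epsilon>_def by (intro tendsto_intros parseval residual_tendsto_0 L2)
    then have \<epsilon>0: "\<epsilon> \<longlonglongrightarrow> 0" by (simp add: disjoint)
    have "summable (\<lambda>k. th n k * t k)"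
      by (rule summable_comparison_test'[OF summable_mult[OF summable_t, of "pi / 2"]])
        (use th_t_le in auto)
    then have lim: "(\<lambda>N. \<Sum>k<N. th n k * t k) \<longlonglongrightarrow> (\<Sum>k. th n k * t k)"
      by (rule summable_LIMSEQ)
    have "(\<Sum>k<K. th n k * (sqrt (ev k) * (coef f k)\<^sup>2)) \<le> real n * \<epsilon> N - (\<Sum>k<N. th n k * t k)" if "K \<le> N" for N
    proof -
      have "(\<Sum>k<K. th n k * (sqrt (ev k) * (coef f k)\<^sup>2)) \<le> (\<Sum>k<N. th n k * (sqrt (ev k) * (coef f k)\<^sup>2))"
        using that th(2) by (intro sum_mono2) (auto simp: eigenvalue_nonneg)
      also have "\<dots> = (\<Sum>k<N. half_weight (real n) (ev k) * (coef p k * coef f k)) - (\<Sum>k<N. th n k * t k)"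
        unfolding sum_subtractf[symmetric]
        by (intro sum.cong) (auto simp: t coef_u half_weight_def th_def algebra_simps power2_eq_square)
      also have "\<dots> \<le> real n * \<epsilon> N - (\<Sum>k<N. th n k * t k)"
        unfolding \<epsilon>_def using half_weight_disjoint[OF L2(2) nonneg(2) L2(1) nonneg(1), of "real n" N] by simp
      finally show ?thesis .
    qed
    moreover have "(\<lambda>N. real n * \<epsilon> N - (\<Sum>k<N. th n k * t k)) \<longlonglongrightarrow> real n * 0 - (\<Sum>k. th n k * t k)"
      by (intro tendsto_intros \<epsilon>0 lim)
    ultimately show ?thesis
      using LIMSEQ_le_const[of "\<lambda>N. real n * \<epsilon> N - (\<Sum>k<N. th n k * t k)"] by auto
  qed
  have th_lim: "(\<lambda>n. th n k * (sqrt (ev k) * y)) \<longlonglongrightarrow> pi / 2 * (sqrt (ev k) * y)" for k y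
  proof (cases "ev k = 0")
    case False
    then have "sqrt (ev k) > 0" using eigenvalue_nonneg[of k] by simp
    from tendsto_mult[OF arctan_scaled_tendsto[OF this] tendsto_const] show ?thesis
      by (simp add: th_def)
  qed simp
  have "(\<lambda>n. \<Sum>k. th n k * t k) \<longlonglongrightarrow> (\<Sum>k. pi / 2 * t k)"
  proof -
    have "\<forall>\<^sub>F (k, n) in at_top \<times>\<^sub>F sequentially. norm (th n k * t k) \<le> pi / 2 * \<bar>t k\<bar>"
      using th_t_le by (intro always_eventually) auto
    then show ?thesis
      using tannerys_theorem[of "\<lambda>k n. th n k * t k" "\<lambda>k. pi / 2 * t k" sequentially "\<lambda>k. pi / 2 * \<bar>t k\<bar>"]
        th_lim summable_t by (auto simp: t)
  qed
  moreover have "(\<Sum>k. pi / 2 * t k) = pi / 2 * L2_inner \<Omega> w f"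
  proof -
    have "t sums L2_inner \<Omega> w f"
      using parseval[OF w(1) L2(1)] by (simp add: sums_def t_def)
    then show ?thesis
      by (intro sums_unique[symmetric] sums_mult)
  qed
  ultimately have "(\<lambda>n. - (\<Sum>k. th n k * t k)) \<longlonglongrightarrow> - (pi / 2 * L2_inner \<Omega> w f)"
    by (intro tendsto_minus) (simp only:)
  moreover have "(\<lambda>n. \<Sum>k<K. th n k * (sqrt (ev k) * (coef f k)\<^sup>2)) \<longlonglongrightarrow> (\<Sum>k<K. pi / 2 * (sqrt (ev k) * (coef f k)\<^sup>2))"
    by (intro tendsto_sum th_lim)
  ultimately have "(\<Sum>k<K. pi / 2 * (sqrt (ev k) * (coef f k)\<^sup>2)) \<le> - (pi / 2 * L2_inner \<Omega> w f)"
    using bound LIMSEQ_le by blast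
  then have "pi / 2 * (\<Sum>k<K. sqrt (ev k) * (coef f k)\<^sup>2) \<le> pi / 2 * (- L2_inner \<Omega> w f)"
    by (simp only: sum_distrib_left mult_minus_right)
  then show ?thesis
    by (rule mult_left_le_imp_le) simp
qed

end

section \<open>Functions of small support\<close>

lemma nn_integral_lborel_translate:
  fixes f :: "'a::euclidean_space \<Rightarrow> ennreal"
  assumes "f \<in> borel_measurable borel"
  shows "(\<integral>\<^sup>+ v. f (x + v) \<partial>lborel) = (\<integral>\<^sup>+ v. f v \<partial>lborel)"
proof -
  have "(\<integral>\<^sup>+ v. f v \<partial>lborel) = (\<integral>\<^sup>+ v. f v \<partial>distr lborel borel ((+) x))"
    by (simp add: lborel_distr_plus)
  also have "\<dots> = (\<integral>\<^sup>+ v. f (x + v) \<partial>lborel)"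
    using assms by (subst nn_integral_distr) auto
  finally show ?thesis by simp
qed

text \<open>If every translation by \<open>v \<in> B\<close> moves \<open>F\<close> little, then \<open>\<integral> F(x) F(x + v) dx \<ge> (3/4)\<parallel>F\<parallel>\<^sup>2\<close> for
  those \<open>v\<close>. Integrating over \<open>B\<close> gives \<open>(3/4) |B| \<parallel>F\<parallel>\<^sup>2 \<le> (\<integral> F)\<^sup>2 \<le> |A| \<parallel>F\<parallel>\<^sup>2\<close>, the last step by
  Cauchy-Schwarz, while \<open>|A| \<le> |B|/2\<close>.\<close>

lemma small_support_large_translation:
  fixes F :: "'a::euclidean_space \<Rightarrow> real"
  assumes F: "bounded_supp F" "\<And>x. 0 \<le> F x"
    and A: "A \<in> sets borel" "\<And>x. x \<notin> A \<Longrightarrow> F x = 0"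
    and B: "B \<in> sets borel" "emeasure lborel B < \<infinity>" "0 < measure lborel B"
    and small: "emeasure lborel A \<le> ennreal (measure lborel B / 2)"
    and close: "\<And>v. v \<in> B \<Longrightarrow> (\<integral>x. (F (x + v) - F x)\<^sup>2 \<partial>lborel) \<le> (\<integral>x. (F x)\<^sup>2 \<partial>lborel) / 2"
  shows "(\<integral>x. (F x)\<^sup>2 \<partial>lborel) = 0"
proof -
  define I where "I = (\<integral>x. (F x)\<^sup>2 \<partial>lborel)"
  define b where "b = measure lborel B"
  have I: "0 \<le> I" by (auto simp: I_def intro!: Bochner_Integration.integral_nonneg)
  have [measurable]: "F \<in> borel_measurable borel" "A \<in> sets borel" "B \<in> sets borel"
    using bounded_supp_measurable[OF F(1)] A B by auto
  have b: "emeasure lborel B = ennreal b"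
    using B(2) by (simp add: b_def emeasure_eq_ennreal_measure)
  have I_eq: "(\<integral>\<^sup>+x. ennreal (F x)^2 \<partial>lborel) = ennreal I"
  proof -
    have "(\<integral>\<^sup>+x. ennreal (F x)^2 \<partial>lborel) = (\<integral>\<^sup>+x. ennreal ((F x)\<^sup>2) \<partial>lborel)"
      by (simp add: ennreal_power F)
    also have "\<dots> = ennreal I"
      unfolding I_def using F by (intro nn_integral_eq_integral integrable_bounded_supp bounded_supp_intros) auto
    finally show ?thesis .
  qed
  have corr: "ennreal (3 / 4 * I) \<le> (\<integral>\<^sup>+x. ennreal (F x) * ennreal (F (x + v)) \<partial>lborel)" if "v \<in> B" for v
  proof -
    note bs = F(1) bounded_supp_translate[OF F(1), of v]
    note int = integrable_bounded_supp[OF bounded_supp_mult[OF bs(2) bs(1)]]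
      bs[THEN bounded_supp_power2, THEN integrable_bounded_supp]
    have "(\<integral>x. (F (x + v) - F x)\<^sup>2 \<partial>lborel) = (\<integral>x. (F (x + v))\<^sup>2 + (F x)\<^sup>2 - 2 * (F (x + v) * F x) \<partial>lborel)"
      by (simp add: power2_diff mult.assoc)
    also have "\<dots> = (\<integral>x. (F (x + v))\<^sup>2 \<partial>lborel) + I - 2 * (\<integral>x. F (x + v) * F x \<partial>lborel)"
      using int by (simp add: I_def)
    also have "(\<integral>x. (F (x + v))\<^sup>2 \<partial>lborel) = I"
      unfolding I_def by (rule integral_lborel_translate) measurable
    finally have "3 / 4 * I \<le> (\<integral>x. F (x + v) * F x \<partial>lborel)"
      using close[OF that] by (simp add: I_def)
    then have "ennreal (3 / 4 * I) \<le> ennreal (\<integral>x. F (x + v) * F x \<partial>lborel)"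
      by (rule ennreal_leI)
    also have "\<dots> = (\<integral>\<^sup>+x. ennreal (F (x + v) * F x) \<partial>lborel)"
      using F by (intro nn_integral_eq_integral[symmetric] int) auto
    also have "\<dots> = (\<integral>\<^sup>+x. ennreal (F x) * ennreal (F (x + v)) \<partial>lborel)"
      using F by (simp add: ennreal_mult mult.commute)
    finally show ?thesis .
  qed
  have "ennreal (3 / 4 * I) * ennreal b = (\<integral>\<^sup>+v. ennreal (3 / 4 * I) * indicator B v \<partial>lborel)"
    by (simp add: nn_integral_cmult_indicator b)
  also have "\<dots> \<le> (\<integral>\<^sup>+v. (\<integral>\<^sup>+x. ennreal (F x) * ennreal (F (x + v)) \<partial>lborel) \<partial>lborel)"
    using corr by (intro nn_integral_mono) (auto simp: indicator_def)
  also have "\<dots> = (\<integral>\<^sup>+x. (\<integral>\<^sup>+v. ennreal (F x) * ennreal (F (x + v)) \<partial>lborel) \<partial>lborel)"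
    by (rule lborel_pair.Fubini') measurable
  also have "\<dots> = (\<integral>\<^sup>+x. ennreal (F x) * (\<integral>\<^sup>+v. ennreal (F v) \<partial>lborel) \<partial>lborel)"
    by (simp add: nn_integral_cmult nn_integral_lborel_translate[of "\<lambda>y. ennreal (F y)"])
  also have "\<dots> = (\<integral>\<^sup>+x. ennreal (F x) \<partial>lborel)\<^sup>2"
    by (simp add: nn_integral_multc power2_eq_square)
  also have "(\<integral>\<^sup>+x. ennreal (F x) \<partial>lborel) = (\<integral>\<^sup>+x. ennreal (F x) * indicator A x \<partial>lborel)"
    using A(2) by (intro nn_integral_cong) (auto simp: indicator_def)
  also have "\<dots>\<^sup>2 \<le> (\<integral>\<^sup>+x. ennreal (F x)^2 \<partial>lborel) * (\<integral>\<^sup>+x. (indicator A x)\<^sup>2 \<partial>lborel)"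
    by (rule Cauchy_Schwarz_nn_integral) auto
  also have "(\<integral>\<^sup>+x. (indicator A x)\<^sup>2 \<partial>lborel) = emeasure lborel A"
  proof -
    have "(indicator A x :: ennreal)\<^sup>2 = indicator A x" for x
      by (simp add: indicator_def)
    then show ?thesis by simp
  qed
  also have "(\<integral>\<^sup>+x. ennreal (F x)^2 \<partial>lborel) * emeasure lborel A \<le> ennreal I * ennreal (b / 2)"
    unfolding I_eq using small by (intro mult_left_mono) (auto simp: b_def)
  finally have "3 / 4 * I * b \<le> I * (b / 2)"
    using I B(3) by (simp add: ennreal_mult[symmetric] b_def)
  then have "I * b \<le> 0" by simp
  then have "I \<le> 0"
    using B(3) by (simp add: mult_le_0_iff b_def[symmetric])
  then show ?thesis
    using I unfolding I_def by (rule antisym)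
qed

text \<open>Finiteness of the essential supremum matters here: \<^const>\<open>enn2real\<close> would turn an infinite one
  into zero.\<close>

lemma essentially_bounded_negative_part:
  assumes "Linf \<Omega> c"
  shows "AE x in lebesgue_on \<Omega>. - Linf_norm \<Omega> (\<lambda>x. max 0 (- c x)) \<le> c x"
proof -
  define cm where "cm x = max 0 (- c x)" for x
  have c: "c \<in> borel_measurable (lebesgue_on \<Omega>)" "esssup (lebesgue_on \<Omega>) (\<lambda>x. ennreal \<bar>c x\<bar>) < \<infinity>"
    using assms by (simp_all add: Linf_def)
  have "cm \<in> borel_measurable (lebesgue_on \<Omega>)"
    unfolding cm_def by (intro borel_measurable_max borel_measurable_const borel_measurable_uminus c)
  then have meas: "(\<lambda>x. ennreal \<bar>cm x\<bar>) \<in> borel_measurable (lebesgue_on \<Omega>)"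
    by (intro measurable_compose[OF _ measurable_ennreal] borel_measurable_abs)
  have "esssup (lebesgue_on \<Omega>) (\<lambda>x. ennreal \<bar>cm x\<bar>) \<le> esssup (lebesgue_on \<Omega>) (\<lambda>x. ennreal \<bar>c x\<bar>)"
    using meas by (rule esssup_mono) (auto simp: cm_def intro!: ennreal_leI)
  then have "esssup (lebesgue_on \<Omega>) (\<lambda>x. ennreal \<bar>cm x\<bar>) < \<infinity>"
    using c(2) by simp
  then have eq: "esssup (lebesgue_on \<Omega>) (\<lambda>x. ennreal \<bar>cm x\<bar>) = ennreal (Linf_norm \<Omega> cm)"
    by (simp add: Linf_norm_def)
  have "AE x in lebesgue_on \<Omega>. ennreal \<bar>cm x\<bar> \<le> ennreal (Linf_norm \<Omega> cm)"
    using esssup_AE[of "\<lambda>x. ennreal \<bar>cm x\<bar>" "lebesgue_on \<Omega>"] by (simp only: eq)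
  then have "AE x in lebesgue_on \<Omega>. - Linf_norm \<Omega> cm \<le> c x"
  proof eventually_elim
    case (elim x)
    have "0 \<le> Linf_norm \<Omega> cm" by (simp add: Linf_norm_def)
    then show ?case using elim by (simp add: cm_def)
  qed
  then show ?thesis by (simp add: cm_def[abs_def])
qed

section \<open>The maximum principle\<close>

context dirichlet_spectrum
begin

text \<open>The radius \<open>1/(16(M + 1))\<close> makes \<open>8 \<bar>v\<bar> M \<le> 1/2\<close> on the ball, so the half-energy bound
  \<open>E \<le> M \<parallel>f\<parallel>\<^sup>2\<close> yields exactly the closeness required by \<open>small_support_large_translation\<close>.\<close>

lemma negative_part_vanishes:
  assumes u: "continuous_on (closure \<Omega>) u"
    and w: "L2 \<Omega> w" "\<And>k. coef w k = sqrt (ev k) * coef u k"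
    and c: "AE x in lebesgue_on \<Omega>. - M \<le> c x" and M: "0 \<le> M"
    and super: "AE x in lebesgue_on \<Omega>. 0 \<le> w x + c x * u x"
    and small: "measure lebesgue (\<Omega> \<inter> {x. u x < 0}) \<le> measure lborel (ball (0::real^'n) (1 / (16 * (M + 1)))) / 2"
  shows "\<forall>x\<in>\<Omega>. 0 \<le> u x"
proof -
  define f where "f x = max 0 (- u x)" for x
  define F where "F = zext \<Omega> f"
  define r where "r = 1 / (16 * (M + 1))"
  have contf: "continuous_on (closure \<Omega>) f"
    unfolding f_def by (intro continuous_intros u)
  have L2u: "L2 \<Omega> u" and L2f: "L2 \<Omega> f"
    using L2_continuous[OF open_dom bounded_dom] u contf by auto
  have bsF: "bounded_supp F"
    unfolding F_def by (rule bounded_supp_zext[OF open_dom bounded_dom contf])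
  define I where "I = (\<integral>x. (F x)\<^sup>2 \<partial>lborel)"
  have I_inner: "L2_inner \<Omega> f f = I"
  proof -
    have "(\<lambda>x. (F x)\<^sup>2) = zext \<Omega> (\<lambda>x. f x * f x)"
      by (auto simp: F_def zext_def power2_eq_square)
    then show ?thesis
      using L2_inner_eq_lborel[OF open_dom bounded_dom contf contf] by (simp add: I_def)
  qed
  have I: "0 \<le> I" unfolding I_inner[symmetric] by (rule L2_inner_self_nonneg)
  have "L2_inner \<Omega> (\<lambda>x. - M * f x) f \<le> L2_inner \<Omega> w f"
  proof (intro L2_inner_mono L2_cmult L2f w(1))
    show "AE x in lebesgue_on \<Omega>. - M * f x * f x \<le> w x * f x"
      using c super
    proof eventually_elim
      case (elim x)
      show ?case
      proof (cases "u x < 0")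
        case True
        have "- M * f x \<le> c x * f x"
          using elim(1) by (intro mult_right_mono) (auto simp: f_def)
        also have "\<dots> \<le> w x" using True elim(2) by (simp add: f_def)
        finally show ?thesis by (intro mult_right_mono) (auto simp: f_def)
      qed (simp add: f_def)
    qed
  qed
  then have energy: "- L2_inner \<Omega> w f \<le> M * I"
    using L2_inner_cmult_left[of \<Omega> "- M" f f] by (simp add: I_inner)
  have E: "(\<Sum>k<N. sqrt (ev k) * (coef f k)\<^sup>2) \<le> M * I" for N
    using half_energy_negative_part[OF L2u w, of N] energy by (simp add: f_def[abs_def])
  define A where "A = \<Omega> \<inter> {x. u x < 0}"
  have contu: "continuous_on \<Omega> u" using u closure_subset by (rule continuous_on_subset)
  have "A = \<Omega> \<inter> u -` {..<0}" by (auto simp: A_def)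
  then have openA: "open A"
    using continuous_open_preimage[OF contu open_dom open_lessThan] by simp
  have "bounded A" using bounded_dom by (rule bounded_subset) (simp add: A_def)
  have "I = 0"
    unfolding I_def
  proof (rule small_support_large_translation[OF bsF])
    show "0 \<le> F x" for x by (simp add: F_def zext_def f_def)
    show "A \<in> sets borel" using openA by simp
    show "F x = 0" if "x \<notin> A" for x
      using that by (auto simp: F_def zext_def f_def A_def)
    show "ball 0 r \<in> sets borel" by simp
    have rpos: "0 < r" using M by (simp add: r_def)
    show fin: "emeasure lborel (ball (0::real^'n) r) < \<infinity>"
      using emeasure_bounded_finite[of "ball (0::real^'n) r"] by simp
    show "0 < measure lborel (ball (0::real^'n) r)"
      using content_ball_pos[OF rpos, of "0::real^'n"] by simp
    have "emeasure lborel A = ennreal (measure lborel A)"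
      using emeasure_bounded_finite[OF \<open>bounded A\<close>] by (simp add: emeasure_eq_ennreal_measure)
    also have "measure lborel A \<le> measure lborel (ball (0::real^'n) r) / 2"
      using small openA by (simp add: A_def[symmetric] r_def measure_completion)
    finally show "emeasure lborel A \<le> ennreal (measure lborel (ball (0::real^'n) r) / 2)"
      by (simp add: ennreal_leI)
    show "(\<integral>x. (F (x + v) - F x)\<^sup>2 \<partial>lborel) \<le> (\<integral>x. (F x)\<^sup>2 \<partial>lborel) / 2" if "v \<in> ball 0 r" for v
    proof -
      have "(\<integral>x. (F (x + v) - F x)\<^sup>2 \<partial>lborel) \<le> 8 * norm v * (M * I)"
        unfolding F_def by (rule translation_half_energy[OF contf E])
      also have "\<dots> = (8 * norm v * M) * I" by simp
      also have "\<dots> \<le> 1 / 2 * I"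
      proof (intro mult_right_mono I)
        have "8 * norm v * M \<le> 8 * r * (M + 1)"
          using that M rpos by (intro mult_mono) auto
        also have "\<dots> = 1 / 2" using M by (simp add: r_def)
        finally show "8 * norm v * M \<le> 1 / 2" .
      qed
      finally show ?thesis by (simp add: I_def)
    qed
  qed
  have "AE x in lborel. (F x)\<^sup>2 = 0"
    using \<open>I = 0\<close> integrable_bounded_supp[OF bounded_supp_power2[OF bsF]]
    by (subst integral_nonneg_eq_0_iff_AE[symmetric]) (auto simp: I_def)
  then have "AE x in lborel. x \<notin> A"
    by eventually_elim (auto simp: F_def zext_def f_def A_def)
  then have "A \<in> null_sets lborel"
    using openA by (subst (asm) AE_iff_null) (auto simp: Collect_neg_eq)
  then have "negligible A"
    by (simp add: negligible_iff_null_sets null_sets_completionI)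
  then have "A = {}" using open_not_negligible[OF openA] by blast
  then show ?thesis by (auto simp: A_def not_less)
qed

end

theorem proposition1p7:
  shows "\<exists>\<delta> :: real \<Rightarrow> real. (\<forall>M\<ge>0. \<delta> M > 0) \<and>
    (\<forall>(\<Omega> :: (real^'n::finite) set) c u w.
       smooth_bounded_domain \<Omega> \<longrightarrow>
       Linf \<Omega> c \<longrightarrow>
       Ck_closure 2 \<Omega> u \<longrightarrow>
       has_half_laplacian \<Omega> u w \<longrightarrow>
       (AE x in lebesgue_on \<Omega>. w x + c x * u x \<ge> 0) \<longrightarrow>
       (\<forall>x\<in>frontier \<Omega>. u x = 0) \<longrightarrow>
       measure lebesgue (\<Omega> \<inter> {x. u x < 0}) \<le> \<delta> (Linf_norm \<Omega> (\<lambda>x. max 0 (- c x))) \<longrightarrow>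
       (\<forall>x\<in>\<Omega>. u x \<ge> 0))"
proof (intro exI conjI allI impI)
  define \<delta> where "\<delta> M = measure lborel (ball (0::real^'n) (1 / (16 * (M + 1)))) / 2" for M :: real
  show "0 < \<delta> M" if "0 \<le> M" for M
    using content_ball_pos[of "1 / (16 * (M + 1))" "0::real^'n"] that by (simp add: \<delta>_def)
  fix \<Omega> :: "(real^'n) set" and c u w
  assume dom: "smooth_bounded_domain \<Omega>" and c: "Linf \<Omega> c" and u: "Ck_closure 2 \<Omega> u"
    and half: "has_half_laplacian \<Omega> u w"
    and super: "AE x in lebesgue_on \<Omega>. 0 \<le> w x + c x * u x"
    and small: "measure lebesgue (\<Omega> \<inter> {x. u x < 0}) \<le> \<delta> (Linf_norm \<Omega> (\<lambda>x. max 0 (- c x)))"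
  from half obtain \<phi> ev a where basis: "dirichlet_eigenbasis \<Omega> \<phi> ev"
    and sums_u: "L2_sums \<Omega> (\<lambda>k x. a k * \<phi> k x) u"
    and sums_w: "L2_sums \<Omega> (\<lambda>k x. a k * sqrt (ev k) * \<phi> k x) w"
    unfolding has_half_laplacian_def by blast
  interpret dirichlet_spectrum \<Omega> \<phi> ev
    using dom basis by unfold_locales (auto simp: smooth_bounded_domain_def)
  show "\<forall>x\<in>\<Omega>. 0 \<le> u x"
  proof (rule negative_part_vanishes[OF _ _ _ essentially_bounded_negative_part[OF c] _ super])
    show "continuous_on (closure \<Omega>) u"
      using u by (simp add: numeral_2_eq_2)
    show "L2 \<Omega> w"
      using sums_w by (simp add: L2_sums_def)
    show "coef w k = sqrt (ev k) * coef u k" for k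
      using coef_L2_sums[OF sums_u] coef_L2_sums[OF sums_w] by simp
    show "0 \<le> Linf_norm \<Omega> (\<lambda>x. max 0 (- c x))"
      by (simp add: Linf_norm_def)
  qed (use small in \<open>simp add: \<delta>_def\<close>)
qed

end
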